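(* As formal power series in $z$, $$\sum_{n \geq 0}A^{\mathrm{maj},\mathrm{exc},\mathrm{fix}}_n(q,t,r)\frac{z^n}{[n]_q!}=\frac{(1-tq)\exp_q(rz)}{\exp_q(ztq)-tq\exp_q(z)}.$$
   Context: For $n\ge 1$ let $\mathfrak S_n$ be the symmetric group on $[n]=\{1,\dots,n\}$, and write $\sigma=\sigma_1\cdots\sigma_n$ with $\sigma_i=\sigma(i)$. Put $\mathrm{DES}(\sigma)=\{i\in[n-1]:\sigma_i>\sigma_{i+1}\}$, $\mathrm{maj}(\sigma)=\sum_{i\in \mathrm{DES}(\sigma)} i$, $\mathrm{exc}(\sigma)=|\{i\in[n-1]:\sigma_i>i\}|$, and let $\mathrm{fix}(\sigma)$ be the number of fixed points of $\sigma$. Define $A_n^{\mathrm{maj},\mathrm{exc},\mathrm{fix}}(q,t,r)=\sum_{\sigma\in\mathfrak S_n}q^{\mathrm{maj}(\sigma)}t^{\mathrm{exc}(\sigma)}r^{\mathrm{fix}(\sigma)}$ for $n\ge1$ and $A_0^{\mathrm{maj},\mathrm{exc},\mathrm{fix}}(q,t,r)=1$. Also $[n]_q=1+q+\cdots+q^{n-1}$, $[0]_q=0$, $[n]_q!=\prod_{j=1}^n[j]_q$, $[0]_q!=1$, and $\exp_q(z)=\sum_{n\ge0}\frac{z^n}{[n]_q!}$. *)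

theory Defs
  imports
    "HOL-Computational_Algebra.Computational_Algebra"
    "HOL-Combinatorics.Permutations"
begin

text \<open>
  A permutation of \<open>[n]\<close> is a function \<open>s\<close> on the naturals with \<open>s permutes {1..n}\<close>;
  its one-line notation is \<open>s 1, \<dots>, s n\<close>.
\<close>

definition DES :: "nat \<Rightarrow> (nat \<Rightarrow> nat) \<Rightarrow> nat set" where
  "DES n s = {i \<in> {1..<n}. s i > s (i + 1)}"

definition maj :: "nat \<Rightarrow> (nat \<Rightarrow> nat) \<Rightarrow> nat" where
  "maj n s = (\<Sum>i\<in>DES n s. i)"

definition exc :: "nat \<Rightarrow> (nat \<Rightarrow> nat) \<Rightarrow> nat" where
  "exc n s = card {i \<in> {1..<n}. s i > i}"

definition fixpts :: "nat \<Rightarrow> (nat \<Rightarrow> nat) \<Rightarrow> nat" where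
  "fixpts n s = card {i \<in> {1..n}. s i = i}"

definition A_maj_exc_fix :: "nat \<Rightarrow> 'a \<Rightarrow> 'a \<Rightarrow> 'a \<Rightarrow> 'a::comm_semiring_1" where
  "A_maj_exc_fix n q t r =
     (\<Sum>s | s permutes {1..n}. q ^ maj n s * t ^ exc n s * r ^ fixpts n s)"

text \<open>For \<open>n = 0\<close> the sum has the identity as its only summand, giving the convention \<open>A\<^sub>0 = 1\<close>:\<close>

lemma A_maj_exc_fix_0: "A_maj_exc_fix 0 q t r = 1"
  by (simp add: A_maj_exc_fix_def maj_def DES_def exc_def fixpts_def)

definition qint :: "'a \<Rightarrow> nat \<Rightarrow> 'a::comm_semiring_1" where
  "qint q n = (\<Sum>i<n. q ^ i)"

definition qfact :: "'a \<Rightarrow> nat \<Rightarrow> 'a::comm_semiring_1" where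
  "qfact q n = (\<Prod>j=1..n. qint q j)"

text \<open>
  The series \<open>exp\<^sub>q(z)\<close> in the variable \<open>z = fps_X\<close>, and the result \<open>exp\<^sub>q(cz)\<close> of
  substituting \<open>cz\<close> for \<open>z\<close>.
\<close>

definition exp_q :: "'a \<Rightarrow> 'a::field fps" where
  "exp_q q = Abs_fps (\<lambda>n. 1 / qfact q n)"

definition exp_q_scaled :: "'a \<Rightarrow> 'a \<Rightarrow> 'a::field fps" where
  "exp_q_scaled q c = exp_q q oo (fps_const c * fps_X)"

text \<open>
  The indeterminates \<open>q\<close>, \<open>t\<close>, \<open>r\<close> live in the fraction field of \<open>\<int>[q][t][r]\<close>, that is, in
  \<open>\<rat>(q,t,r)\<close>: \<open>r\<close> is the variable of the outermost polynomial ring, \<open>q\<close> that of the innermost.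
\<close>

type_synonym ratfun = "int poly poly poly fract"

definition q_var :: ratfun where "q_var = to_fract [:[:[:0, 1:]:]:]"
definition t_var :: ratfun where "t_var = to_fract [:[:0, 1:]:]"
definition r_var :: ratfun where "r_var = to_fract [:0, 1:]"

text \<open>
  No division by zero is involved: \<open>[n]\<^sub>q!\<close> is nonzero, and \<open>exp\<^sub>q(ztq) - tq exp\<^sub>q(z)\<close> has
  the nonzero constant term \<open>1 - tq\<close>, so it is a unit.
\<close>

lemma qint_q_var: "qint q_var n = to_fract [:[:qint [:0, 1:] n:]:]"
proof -
  have pow: "q_var ^ i = to_fract [:[:[:0, 1:] ^ i:]:]" for i
    by (induction i) (simp_all add: q_var_def flip: to_fract_mult to_fract_1 one_pCons)
  show ?thesis
    unfolding qint_def pow by (induction n) (simp_all flip: to_fract_add)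
qed

lemma qfact_q_var_nonzero: "qfact q_var n \<noteq> 0"
proof -
  have "qint ([:0, 1:] :: int poly) j \<noteq> 0" if "j \<ge> 1" for j
  proof
    assume "qint ([:0, 1:] :: int poly) j = 0"
    then have "poly (qint [:0, 1:] j) (1::int) = 0" by simp
    then show False using that by (simp add: qint_def poly_sum)
  qed
  then show ?thesis by (simp add: qfact_def qint_q_var)
qed

lemma one_minus_tq_nonzero: "1 - t_var * q_var \<noteq> 0"
proof -
  have "1 - t_var * q_var = to_fract (1 - [:[:0, 1:]:] * [:[:[:0, 1:]:]:])"
    by (simp only: t_var_def q_var_def to_fract_diff to_fract_mult to_fract_1)
  moreover have "1 - [:[:0, 1:]:] * [:[:[:0, 1:]:]:] \<noteq> (0 :: int poly poly poly)"
    by (simp add: one_pCons)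
  ultimately show ?thesis by (simp only: to_fract_eq_0_iff not_False_eq_True)
qed

lemma denominator_unit:
  "(exp_q_scaled q_var (t_var * q_var) - fps_const (t_var * q_var) * exp_q q_var) $ 0 \<noteq> 0"
  using one_minus_tq_nonzero by (simp add: exp_q_scaled_def exp_q_def qfact_def)

end

theory Submission
  imports Defs
begin

text \<open>
  Refining the sum makes it computable. An \<^emph>\<open>open permutation\<close> of length \<open>N\<close> with \<open>k\<close> up values is
  a word of \<open>N\<close> distinct numbers consisting of exactly \<open>N - k\<close> values below \<open>N\<close> and of \<open>k\<close> values
  \<open>\<ge> N\<close>, of which only the relative order matters. Prefixes of permutations are of this kind, and
  ordinary permutations are the case \<open>k = 0\<close>. Let \<open>b N k\<close> be the sum of
  \<open>q\<^bsup>maj\<^esup> t\<^bsup>exc\<^esup> r\<^bsup>fix\<^esup>\<close> over these words, divided by \<open>(1 - q)\<cdots>(1 - q\<^sup>N)\<close>.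

  The numbers \<open>b N k\<close> obey a recurrence in \<open>N\<close>. Expanding \<open>q\<^bsup>maj\<^esup> / ((1 - q)\<cdots>(1 - q\<^sup>N))\<close> over
  all ways to cut off an increasing final block (\<open>maj_over_qpoch_eq_sum_final_blocks\<close>) turns the
  major index of a word into the major index of a shorter prefix. The prefix is again an open
  permutation, and the increasing block is determined by its set of values, whose contribution to
  \<open>t\<^bsup>exc\<^esup> r\<^bsup>fix\<^esup>\<close> is a product over the gaps between the values that it leaves out. The outcome,
  \<open>open_sum_recurrence\<close>, expresses \<open>b n\<close> by the \<open>b N\<close> with \<open>N \<le> n\<close> through a kernel that does
  not involve \<open>q\<close>; the summand \<open>N = n\<close> is \<open>q\<^sup>n (b n k)\<close>, so that the recurrence has only one
  solution for given \<open>b 0\<close>.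

  In terms of \<open>b\<^sub>k(z) = \<Sum>\<^sub>N b N k z\<^sup>N\<close> the recurrence expresses the series \<open>b\<^sub>k(z)\<close> by the series
  \<open>b\<^sub>j(qz)\<close>. The kernel sends every family that is geometric in the index, \<open>G L\<^sup>j\<close>, to
  a geometric family (\<open>geometric_family_kernel\<close>), because its sum over the number \<open>d\<close> of block
  entries with values below \<open>N\<close> is a sum of diagonal coefficients,
  \<open>\<Sum>\<^sub>d [h\<^sup>d] ((a + bh)\<^sup>d p(h)) = p(a/(1-b))/(1-b)\<close>. Hence the solution is \<open>F(z) L(z)\<^sup>k\<close>, where
  \<open>F = H(rz)/D(z)\<close>, \<open>L = (H(tz) - D(z))/D(z)\<close>, \<open>H(z) = exp\<^sub>q(z/(1-q))\<close> and
  \<open>D(z) = (H(tqz) - tq H(z))/(1 - tq)\<close>: the transition from \<open>qz\<close> to \<open>z\<close> is checked with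
  \<open>H(qz) = (1 - z) H(z)\<close> and \<open>D(qz) = (1 - z) D(z) + z H(tqz)\<close>. The case \<open>k = 0\<close> says that
  \<open>\<Sum>\<^sub>n A\<^sub>n z\<^sup>n / ((1 - q)\<cdots>(1 - q\<^sup>n)) = H(rz)/D(z)\<close>, and replacing \<open>z\<close> by \<open>(1-q)z\<close> gives the
  claim.
\<close>

section \<open>Open permutations\<close>

text \<open>
  Words are lists indexed from \<open>0\<close>, and their values also start at \<open>0\<close>. The weight of the entry
  \<open>v\<close> at position \<open>i\<close> is its contribution to \<open>t\<^bsup>exc\<^esup> r\<^bsup>fix\<^esup>\<close>.
\<close>
definition arrow_wt :: "'a \<Rightarrow> 'a \<Rightarrow> nat \<Rightarrow> nat \<Rightarrow> 'a::comm_semiring_1" where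
  "arrow_wt t r i v = (if i < v then t else if v = i then r else 1)"

definition list_wt :: "'a \<Rightarrow> 'a \<Rightarrow> nat list \<Rightarrow> 'a::comm_semiring_1" where
  "list_wt t r xs = (\<Prod>i<length xs. arrow_wt t r i (xs ! i))"

text \<open>
  The summand is \<open>Suc i\<close> because a descent between the list positions \<open>i\<close> and \<open>i + 1\<close> is a descent
  at place \<open>i + 1\<close> of the one-line notation.
\<close>
definition list_maj :: "nat list \<Rightarrow> nat" where
  "list_maj xs = (\<Sum>i | Suc i < length xs \<and> xs ! Suc i < xs ! i. Suc i)"

text \<open>
  Prefixes of length \<open>N\<close> of permutations whose values \<open>\<ge> N\<close> form the set \<open>W\<close>. Exactly
  \<open>card W\<close> values below \<open>N\<close> are then left for the entries after the prefix.
\<close>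
definition open_perms :: "nat \<Rightarrow> nat set \<Rightarrow> nat list set" where
  "open_perms N W =
     {xs. length xs = N \<and> distinct xs \<and> set xs \<subseteq> {..<N} \<union> W \<and> W \<subseteq> set xs}"

definition open_sum :: "'a \<Rightarrow> 'a \<Rightarrow> 'a \<Rightarrow> nat \<Rightarrow> nat set \<Rightarrow> 'a::comm_semiring_1" where
  "open_sum q t r N W = (\<Sum>xs\<in>open_perms N W. q ^ list_maj xs * list_wt t r xs)"

text \<open>
  The \<open>q\<close>-Pochhammer symbol \<open>(q;q)\<^sub>n\<close>, which is \<open>(1 - q)\<^sup>n [n]\<^sub>q!\<close>.
\<close>
definition qpoch :: "'a \<Rightarrow> nat \<Rightarrow> 'a::comm_ring_1" where
  "qpoch q n = (\<Prod>i=1..n. 1 - q ^ i)"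

lemma qpoch_0 [simp]: "qpoch q 0 = 1"
  and qpoch_Suc: "qpoch q (Suc n) = qpoch q n * (1 - q ^ Suc n)"
  by (simp_all add: qpoch_def)

lemma finite_open_perms [simp]: "finite W \<Longrightarrow> finite (open_perms N W)"
  unfolding open_perms_def
  by (rule finite_subset[OF _ finite_lists_length_eq[of "{..<N} \<union> W" N]]) auto

lemma list_maj_snoc:
  "list_maj (xs @ [x]) = list_maj xs + (if xs \<noteq> [] \<and> x < last xs then length xs else 0)"
proof (cases xs rule: rev_cases)
  case Nil
  then show ?thesis by (simp add: list_maj_def)
next
  case (snoc ys y)
  let ?D = "{i. Suc i < length xs \<and> xs ! Suc i < xs ! i}"
  have fin: "finite ?D"
    by (rule finite_subset[of _ "{..<length xs}"]) auto
  have "{i. Suc i < length (xs @ [x]) \<and> (xs @ [x]) ! Suc i < (xs @ [x]) ! i} =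
        (if x < y then insert (length ys) ?D else ?D)"
    unfolding snoc by (auto simp: nth_append less_Suc_eq)
  moreover have "length ys \<notin> ?D"
    using snoc by simp
  ultimately show ?thesis
    using fin snoc by (simp add: list_maj_def)
qed

lemma list_wt_append:
  "list_wt t r (ys @ zs) =
     list_wt t r ys * (\<Prod>i<length zs. arrow_wt t r (length ys + i) (zs ! i))"
proof -
  have "list_wt t r (ys @ zs) =
      (\<Prod>i<length ys. arrow_wt t r i ((ys @ zs) ! i)) *
      (\<Prod>i\<in>{length ys..<length ys + length zs}. arrow_wt t r i ((ys @ zs) ! i))"
    unfolding list_wt_def length_append
    by (subst prod.union_disjoint[symmetric]) (auto intro!: prod.cong)
  also have "(\<Prod>i\<in>{length ys..<length ys + length zs}. arrow_wt t r i ((ys @ zs) ! i)) =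
      (\<Prod>i<length zs. arrow_wt t r (length ys + i) (zs ! i))"
    by (rule prod.reindex_bij_witness[of _ "\<lambda>i. length ys + i" "\<lambda>i. i - length ys"])
       (auto simp: nth_append)
  finally show ?thesis
    by (simp add: list_wt_def nth_append)
qed

section \<open>Cutting off an increasing final block\<close>

text \<open>
  The quotient on the left is the sum of \<open>q\<^bsup>s\<^sub>1 + \<dots> + s\<^sub>n\<^esup>\<close> over the sequences
  \<open>s\<^sub>1 \<ge> \<dots> \<ge> s\<^sub>n \<ge> 0\<close> that decrease strictly at each descent of the word. The word increases on the
  set where \<open>s = 0\<close>, a final segment; removing that segment and subtracting \<open>1\<close> from the remaining
  \<open>N\<close> parts gives the summand on the right. The proof is an induction that avoids the sequences: if
  the appended letter makes a descent, only two cuts survive; otherwise all earlier cuts do, and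
  \<open>q\<^bsup>n+1\<^esup> / (q;q)\<^sub>n\<^sub>+\<^sub>1 + 1 / (q;q)\<^sub>n = 1 / (q;q)\<^sub>n\<^sub>+\<^sub>1\<close>.
\<close>
lemma maj_over_qpoch_eq_sum_final_blocks:
  fixes q :: "'a::field"
  assumes nz: "\<And>n. qpoch q n \<noteq> 0" and "distinct xs"
  shows "q ^ list_maj xs / qpoch q (length xs) =
    (\<Sum>N | N \<le> length xs \<and> sorted (drop N xs). q ^ N * q ^ list_maj (take N xs) / qpoch q N)"
  using \<open>distinct xs\<close>
proof (induction xs rule: rev_induct)
  case Nil
  have "{N::nat. N \<le> length ([]::nat list) \<and> sorted (drop N ([]::nat list))} = {0}"
    by auto
  then show ?case by simp
next
  case (snoc x xs)
  let ?n = "length xs"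
  let ?S = "\<lambda>xs. {N. N \<le> length xs \<and> sorted (drop N xs)}"
  let ?f = "\<lambda>xs N. q ^ N * q ^ list_maj (take N xs) / qpoch q N"
  have top: "?f (xs @ [x]) (Suc ?n) = q ^ Suc ?n * q ^ list_maj (xs @ [x]) / qpoch q (Suc ?n)"
    by simp
  have rest: "1 / qpoch q ?n = (1 - q ^ Suc ?n) / qpoch q (Suc ?n)"
    using nz[of "?n"] nz[of "Suc ?n"] by (simp add: qpoch_Suc field_simps)
  show ?case
  proof (cases "xs \<noteq> [] \<and> x < last xs")
    case True
    \<comment> \<open>The appended letter ends a descent, so only the empty block and the block \<open>[x]\<close> remain.\<close>
    have notsorted: "\<not> sorted (drop N xs @ [x])" if "N < ?n" for N
    proof -
      have "last xs \<in> set (drop N xs)"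
        using that True by (metis last_drop last_in_set drop_eq_Nil2 not_le)
      then show ?thesis
        using True by (auto simp: sorted_append not_le)
    qed
    have "?S (xs @ [x]) = {Suc ?n, ?n}"
    proof (rule set_eqI)
      fix N
      consider "N < ?n" | "N = ?n" | "N = Suc ?n" | "N > Suc ?n" by linarith
      then show "N \<in> ?S (xs @ [x]) \<longleftrightarrow> N \<in> {Suc ?n, ?n}"
        by cases (use notsorted in \<open>auto\<close>)
    qed
    then have "(\<Sum>N\<in>?S (xs @ [x]). ?f (xs @ [x]) N) =
        ?f (xs @ [x]) (Suc ?n) + q ^ ?n * q ^ list_maj xs * (1 / qpoch q ?n)"
      by simp
    also have "\<dots> = q ^ list_maj (xs @ [x]) / qpoch q (Suc ?n)"
      unfolding top rest using True nz[of "Suc ?n"]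
      by (simp add: list_maj_snoc power_add field_simps)
    finally show ?thesis by simp
  next
    case False
    have ext: "sorted (drop N xs @ [x]) = sorted (drop N xs)" if "N \<le> ?n" for N
    proof -
      have "y \<le> x" if "sorted (drop N xs)" "y \<in> set (drop N xs)" for y
      proof -
        have "drop N xs \<noteq> []" using that by auto
        then obtain zs z where z: "drop N xs = zs @ [z]"
          by (metis rev_exhaust)
        have xs: "xs = take N xs @ zs @ [z]"
          unfolding z[symmetric] by simp
        have "last xs = z" "xs \<noteq> []"
          by (subst xs, simp)+
        moreover have "y \<le> z" using that unfolding z by (auto simp: sorted_append)
        ultimately show "y \<le> x" using False by auto
      qed
      then show ?thesis by (auto simp: sorted_append)
    qed
    have S: "?S (xs @ [x]) = insert (Suc ?n) (?S xs)"
      using ext by (auto simp: le_Suc_eq)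
    have fin: "finite (?S xs)" by simp
    have "(\<Sum>N\<in>?S (xs @ [x]). ?f (xs @ [x]) N) =
        ?f (xs @ [x]) (Suc ?n) + (\<Sum>N\<in>?S xs. ?f (xs @ [x]) N)"
      unfolding S by (rule sum.insert) auto
    also have "(\<Sum>N\<in>?S xs. ?f (xs @ [x]) N) = (\<Sum>N\<in>?S xs. ?f xs N)"
      by (rule sum.cong) auto
    also have "\<dots> = q ^ list_maj xs * (1 / qpoch q ?n)"
      using snoc by simp
    also have "?f (xs @ [x]) (Suc ?n) + \<dots> = q ^ list_maj (xs @ [x]) / qpoch q (Suc ?n)"
      unfolding top rest using False nz[of "Suc ?n"]
      by (auto simp add: list_maj_snoc field_simps)
    finally show ?thesis by simp
  qed
qed

text \<open>
  Squeezing the values \<open>\<ge> N\<close> together in an order-preserving way keeps all descents, and it keeps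
  excedances and fixed points because every position is smaller than \<open>N\<close>.
\<close>
lemma open_sum_relabel:
  assumes "finite W" and "W \<subseteq> {N..}"
  shows "open_sum q t r N W = open_sum q t r N {N..<N + card W}"
proof -
  let ?k = "card W"
  obtain h where h: "bij_betw h {..<?k} W" and mono: "strict_mono_on {..<?k} h"
    using ex_bij_betw_strict_mono_card[OF \<open>finite W\<close>] by blast
  define g where "g v = (if v < N then v else h (v - N))" for v
  have hW: "h i \<in> W" if "i < ?k" for i
    using h that by (auto simp: bij_betw_def)
  have hN: "N \<le> h i" if "i < ?k" for i
    using hW[OF that] assms by auto
  \<comment> \<open>\<open>g\<close> fixes everything below \<open>N\<close> and enumerates \<open>W\<close> increasingly from \<open>N\<close> on.\<close>
  have mono_g: "g v < g w" if "v < w" "w < N + ?k" for v w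
  proof -
    consider "w < N" | "v < N" "N \<le> w" | "N \<le> v" using \<open>v < w\<close> by linarith
    then show ?thesis
    proof cases
      case 1
      then show ?thesis using that by (simp add: g_def)
    next
      case 2
      then have "N \<le> h (w - N)" using that by (intro hN) simp
      then show ?thesis using 2 by (simp add: g_def)
    next
      case 3
      then show ?thesis
        using that mono[THEN strict_mono_onD, of "v - N" "w - N"] by (simp add: g_def)
    qed
  qed
  have inj: "inj_on g {..<N + ?k}"
  proof (rule inj_onI)
    fix v w assume "v \<in> {..<N + ?k}" "w \<in> {..<N + ?k}" "g v = g w"
    then show "v = w" using mono_g[of v w] mono_g[of w v] by (cases v w rule: linorder_cases) auto
  qed
  have less_iff: "g v < g w \<longleftrightarrow> v < w" if "v < N + ?k" "w < N + ?k" for v w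
    using mono_g[of v w] mono_g[of w v] that by (cases v w rule: linorder_cases) auto
  have low: "g v = v" if "v < N" for v
    using that by (simp add: g_def)
  have img_low: "g ` {..<N} = {..<N}"
    using low by simp
  have img_high: "g ` {N..<N + ?k} = W"
  proof -
    have "{N..<N + ?k} = (\<lambda>i. N + i) ` {..<?k}"
      by (simp add: lessThan_atLeast0 add.commute)
    then have "g ` {N..<N + ?k} = (\<lambda>i. g (N + i)) ` {..<?k}"
      by (simp only: image_image)
    then have "g ` {N..<N + ?k} = h ` {..<?k}"
      by (simp add: g_def)
    then show ?thesis using h by (simp add: bij_betw_def)
  qed
  have split: "{..<N} \<union> {N..<N + ?k} = {..<N + ?k}" by auto
  have img: "g ` {..<N + ?k} = {..<N} \<union> W"
    unfolding split[symmetric] image_Un img_low img_high ..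
  have bij: "bij_betw (map g) (open_perms N {N..<N + ?k}) (open_perms N W)"
    unfolding bij_betw_def
  proof
    show "inj_on (map g) (open_perms N {N..<N + ?k})"
    proof (rule inj_onI)
      fix xs ys assume *: "xs \<in> open_perms N {N..<N + ?k}" "ys \<in> open_perms N {N..<N + ?k}"
        and "map g xs = map g ys"
      moreover have "inj_on g (set xs \<union> set ys)"
      proof (rule inj_on_subset[OF inj])
        show "set xs \<union> set ys \<subseteq> {..<N + ?k}"
          using * unfolding open_perms_def split by blast
      qed
      ultimately show "xs = ys" by (metis map_inj_on)
    qed
    have image_mem: "map g xs \<in> open_perms N W \<longleftrightarrow> xs \<in> open_perms N {N..<N + ?k}"
      if "set xs \<subseteq> {..<N + ?k}" for xs
    proof -
      have "g ` {N..<N + ?k} \<subseteq> g ` set xs \<longleftrightarrow> {N..<N + ?k} \<subseteq> set xs"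
        using inj_on_image_mem_iff[OF inj _ that] by (fastforce simp: image_subset_iff)
      then have "W \<subseteq> g ` set xs \<longleftrightarrow> {N..<N + ?k} \<subseteq> set xs"
        by (simp only: img_high)
      moreover have "distinct (map g xs) \<longleftrightarrow> distinct xs"
        using inj_on_subset[OF inj that] by (simp add: distinct_map)
      moreover have "g ` set xs \<subseteq> {..<N} \<union> W"
        using that img by blast
      ultimately show ?thesis
        using that by (auto simp: open_perms_def split)
    qed
    show "map g ` open_perms N {N..<N + ?k} = open_perms N W"
    proof (intro equalityI subsetI)
      fix ys assume ys: "ys \<in> open_perms N W"
      then have "ys \<in> lists (g ` {..<N + ?k})"
        by (auto simp: open_perms_def img)
      then obtain xs where "xs \<in> lists {..<N + ?k}" "ys = map g xs"
        unfolding lists_image by blast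
      then show "ys \<in> map g ` open_perms N {N..<N + ?k}"
        using image_mem[of xs] ys by auto
    next
      fix ys assume "ys \<in> map g ` open_perms N {N..<N + ?k}"
      then obtain xs where xs: "xs \<in> open_perms N {N..<N + ?k}" "ys = map g xs" by auto
      then have "set xs \<subseteq> {..<N + ?k}" unfolding open_perms_def split by blast
      then show "ys \<in> open_perms N W" using image_mem xs by blast
    qed
  qed
  have "list_maj (map g xs) = list_maj xs \<and> list_wt t r (map g xs) = list_wt t r xs"
    if "xs \<in> open_perms N {N..<N + ?k}" for xs
  proof
    have len: "length xs = N" and sub: "xs ! i < N + ?k" if "i < N" for i
      using \<open>xs \<in> _\<close> that unfolding open_perms_def split by (auto dest!: nth_mem)
    have len: "length xs = N" using \<open>xs \<in> _\<close> by (simp add: open_perms_def)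
    show "list_maj (map g xs) = list_maj xs"
      unfolding list_maj_def
      by (rule sum.cong) (auto simp: len less_iff sub)
    have "(i < g v \<longleftrightarrow> i < v) \<and> (g v = i \<longleftrightarrow> v = i)" if "i < N" "v < N + ?k" for i v
    proof (cases "v < N")
      case True
      then show ?thesis by (simp add: g_def)
    next
      case False
      then have "N \<le> h (v - N)" using that by (intro hN) linarith
      then show ?thesis using False that by (auto simp: g_def)
    qed
    then show "list_wt t r (map g xs) = list_wt t r xs"
      unfolding list_wt_def arrow_wt_def
      by (intro prod.cong) (auto simp: len sub)
  qed
  then show ?thesis
    unfolding open_sum_def
    by (subst sum.reindex_bij_betw[OF bij, symmetric]) (auto intro!: sum.cong)
qed

lemma sum_Pow_card:
  fixes f :: "nat \<Rightarrow> 'a::comm_semiring_1"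
  assumes "finite A"
  shows "(\<Sum>X\<in>Pow A. f (card X)) = (\<Sum>i\<le>card A. of_nat (card A choose i) * f i)"
proof -
  have "(\<Sum>X\<in>Pow A. f (card X)) = (\<Sum>i\<le>card A. \<Sum>X | X \<in> Pow A \<and> card X = i. f (card X))"
    using assms by (intro sum.group[symmetric]) (auto intro: card_mono)
  also have "\<dots> = (\<Sum>i\<le>card A. of_nat (card {X. X \<subseteq> A \<and> card X = i}) * f i)"
    by (intro sum.cong) auto
  finally show ?thesis
    using n_subsets[OF assms] by simp
qed

lemma sum_Pow_Un:
  assumes "A \<inter> B = {}"
  shows "(\<Sum>X\<in>Pow (A \<union> B). f X) = (\<Sum>X\<in>Pow A. \<Sum>Y\<in>Pow B. f (X \<union> Y))"
  unfolding sum.cartesian_product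
proof (rule sum.reindex_bij_witness[of _ "\<lambda>(X, Y). X \<union> Y" "\<lambda>X. (X \<inter> A, X \<inter> B)"], goal_cases)
  case (1 X)
  then have "X \<inter> A \<union> X \<inter> B = X" by blast
  then show ?case by simp
next
  case (5 X)
  then have "X \<inter> A \<union> X \<inter> B = X" by blast
  then show ?case by simp
qed (use assms in auto)

text \<open>
  The weight of the increasing word with value set \<open>X\<close> on the positions \<open>p, p + 1, \<dots>\<close>: the
  position of a value is \<open>p\<close> plus its rank in \<open>X\<close>.
\<close>
definition block_wt :: "'a \<Rightarrow> 'a \<Rightarrow> nat \<Rightarrow> nat set \<Rightarrow> 'a::comm_semiring_1" where
  "block_wt t r p X = (\<Prod>x\<in>X. arrow_wt t r (p + card {y \<in> X. y < x}) x)"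

lemma prod_sorted_list_eq_block_wt:
  assumes "finite X"
  shows "(\<Prod>i<card X. arrow_wt t r (p + i) (sorted_list_of_set X ! i)) = block_wt t r p X"
proof -
  let ?zs = "sorted_list_of_set X"
  have bij: "bij_betw ((!) ?zs) {..<card X} X"
    using assms by (intro bij_betw_nth) auto
  have less: "?zs ! j < ?zs ! i \<longleftrightarrow> j < i" if "i < card X" "j < card X" for i j
    using that sorted_wrt_nth_less[OF strict_sorted_list_of_set[of X]]
    by (metis less_asym linorder_neqE_nat length_sorted_list_of_set nat_neq_iff)
  have "card {y \<in> X. y < ?zs ! i} = i" if "i < card X" for i
  proof -
    have "{y \<in> X. y < ?zs ! i} = (!) ?zs ` {..<i}"
    proof (intro equalityI subsetI)
      fix y assume "y \<in> {y \<in> X. y < ?zs ! i}"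
      moreover from this obtain j where "j < card X" "y = ?zs ! j"
        using bij by (auto simp: bij_betw_def)
      ultimately show "y \<in> (!) ?zs ` {..<i}" using less[OF that] by auto
    next
      fix y assume "y \<in> (!) ?zs ` {..<i}"
      then obtain j where "j < i" "y = ?zs ! j" by auto
      then show "y \<in> {y \<in> X. y < ?zs ! i}"
        using less[OF that, of j] that bij_betw_apply[OF bij, of j] by auto
    qed
    moreover have "inj_on ((!) ?zs) {..<i}"
      using bij that by (auto simp: bij_betw_def intro: inj_on_subset)
    ultimately show ?thesis by (simp add: card_image)
  qed
  then show ?thesis
    unfolding block_wt_def by (subst prod.reindex_bij_betw[OF bij, symmetric]) simp
qed

text \<open>
  A word of length \<open>N + m\<close> that increases from position \<open>N\<close> on is given by its prefix \<open>ys\<close>, with set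
  \<open>V\<close> of values \<open>\<ge> N\<close>, and the value set \<open>X\<close> of the final block.
\<close>
lemma sum_final_block:
  "(\<Sum>xs | xs \<in> open_perms (N + m) {N + m..<N + m + k} \<and> sorted (drop N xs).
      q ^ list_maj (take N xs) * list_wt t r xs) =
   (\<Sum>V\<in>Pow {N..<N + m + k}. \<Sum>ys\<in>open_perms N V. q ^ list_maj ys * list_wt t r ys *
      (\<Sum>X | X \<subseteq> {..<N + m + k} - set ys \<and> card X = m \<and> {N + m..<N + m + k} \<subseteq> V \<union> X.
        block_wt t r N X))"
  (is "?L = ?R")
proof -
  let ?T = "{N + m..<N + m + k}"
  let ?XS = "\<lambda>V ys. {X. X \<subseteq> {..<N + m + k} - set ys \<and> card X = m \<and> ?T \<subseteq> V \<union> X}"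
  let ?Q = "SIGMA V : Pow {N..<N + m + k}. SIGMA ys : open_perms N V. ?XS V ys"
  have finXS: "finite (?XS V ys)" for V ys
    by (rule finite_subset[of _ "Pow {..<N + m + k}"]) auto
  have finV: "finite V" if "V \<in> Pow {N..<N + m + k}" for V
    using that by (auto intro: finite_subset)
  have "?R = (\<Sum>V\<in>Pow {N..<N + m + k}. \<Sum>(ys, X)\<in>Sigma (open_perms N V) (?XS V).
      q ^ list_maj ys * list_wt t r ys * block_wt t r N X)"
    by (intro sum.cong refl)
       (simp add: sum_distrib_left sum.Sigma finXS finV del: Pow_iff)
  also have "\<dots> = (\<Sum>(V, ys, X)\<in>?Q. q ^ list_maj ys * list_wt t r ys * block_wt t r N X)"
    by (subst sum.Sigma) (use finXS finV in \<open>auto intro!: finite_SigmaI simp del: Pow_iff\<close>)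
  also have "\<dots> = ?L"
  proof (rule sum.reindex_bij_witness[of _
        "\<lambda>xs. ({v \<in> set (take N xs). N \<le> v}, take N xs, set (drop N xs))"
        "\<lambda>(V, ys, X). ys @ sorted_list_of_set X"], goal_cases)
    case (1 a)
    then obtain V ys X where a: "a = (V, ys, X)" and V: "V \<subseteq> {N..<N + m + k}"
      and ys: "ys \<in> open_perms N V" and X: "X \<in> ?XS V ys"
      by auto
    have "finite X" using X by (auto intro: finite_subset)
    moreover have "{v \<in> set ys. N \<le> v} = V"
      using ys V by (auto simp: open_perms_def)
    ultimately show ?case using ys by (simp add: a open_perms_def)
  next
    case (2 a)
    then obtain V ys X where a: "a = (V, ys, X)" and V: "V \<subseteq> {N..<N + m + k}"
      and ys: "ys \<in> open_perms N V" and X: "X \<in> ?XS V ys"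
      by auto
    have fin: "finite X" using X by (auto intro: finite_subset)
    have "set ys \<subseteq> {..<N + m + k}"
      using ys V by (fastforce simp: open_perms_def)
    then show ?case using ys X fin by (auto simp: a open_perms_def)
  next
    case (3 xs)
    then have "sorted (drop N xs)" "distinct (drop N xs)"
      by (auto simp: open_perms_def)
    then show ?case by (simp add: sorted_list_of_set.idem_if_sorted_distinct)
  next
    case (4 xs)
    then have xs: "length xs = N + m" "distinct xs" "set xs \<subseteq> {..<N + m + k}" "?T \<subseteq> set xs"
      and so: "sorted (drop N xs)"
      by (auto simp: open_perms_def)
    have app: "set xs = set (take N xs) \<union> set (drop N xs)"
      by (metis append_take_drop_id set_append)
    have disj: "set (take N xs) \<inter> set (drop N xs) = {}"
      using xs(2) by (metis append_take_drop_id distinct_append)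
    have "take N xs \<in> open_perms N {v \<in> set (take N xs). N \<le> v}"
      using xs by (auto simp: open_perms_def)
    moreover have "{v \<in> set (take N xs). N \<le> v} \<subseteq> {N..<N + m + k}"
      using xs(3) app by auto
    moreover have "set (drop N xs) \<in> ?XS {v \<in> set (take N xs). N \<le> v} (take N xs)"
    proof -
      have "set (drop N xs) \<subseteq> {..<N + m + k} - set (take N xs)"
        using xs(3) app disj by auto
      moreover have "card (set (drop N xs)) = m"
        using xs by (simp add: distinct_card)
      moreover have "?T \<subseteq> {v \<in> set (take N xs). N \<le> v} \<union> set (drop N xs)"
        using xs(4) app by auto
      ultimately show ?thesis by simp
    qed
    ultimately show ?case by simp
  next
    case (5 a)
    then obtain V ys X where a: "a = (V, ys, X)" and V: "V \<subseteq> {N..<N + m + k}"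
      and ys: "ys \<in> open_perms N V" and X: "X \<in> ?XS V ys"
      by auto
    have fin: "finite X" using X by (auto intro: finite_subset)
    have "length ys = N" "card X = m" using ys X by (auto simp: open_perms_def)
    then show ?case
      using prod_sorted_list_eq_block_wt[OF fin, of t r N]
      by (simp add: a list_wt_append mult.assoc)
  qed
  finally show ?thesis by (rule sym)
qed

section \<open>The weight of a final block\<close>

lemma disjoint_below_above:
  fixes N :: nat
  assumes "L \<subseteq> {..<N}" and "Y \<subseteq> {N..}"
  shows "L \<inter> Y = {}"
proof -
  have "{..<N} \<inter> {N..} = {}" by auto
  then show ?thesis using assms by blast
qed

text \<open>
  The values in \<open>L\<close> come first in the block and lie below their positions, hence have weight \<open>1\<close>;
  their only effect is to move the values in \<open>Y\<close> to the right.
\<close>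
lemma block_wt_low_high:
  assumes "L \<subseteq> {..<N}" and "Y \<subseteq> {N..}" and "finite Y"
  shows "block_wt t r N (L \<union> Y) = block_wt t r (N + card L) Y"
proof -
  have finL: "finite L" using assms(1) finite_subset by blast
  have disj: "L \<inter> Y = {}" using assms(1,2) by (rule disjoint_below_above)
  have 1: "arrow_wt t r (N + card {y \<in> L \<union> Y. y < x}) x = 1" if "x \<in> L" for x
    using that assms(1) by (auto simp: arrow_wt_def)
  have 2: "card {y \<in> L \<union> Y. y < x} = card L + card {y \<in> Y. y < x}" if "x \<in> Y" for x
  proof -
    have "{y \<in> L \<union> Y. y < x} = L \<union> {y \<in> Y. y < x}"
      using that assms(1,2) by (auto simp: subset_iff intro: less_le_trans)
    then show ?thesis
      using finL assms(3) disj by (simp add: card_Un_disjoint disjoint_iff)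
  qed
  show ?thesis
    unfolding block_wt_def
    using finL assms(3) disj 1 2 by (simp add: prod.union_disjoint add.assoc)
qed

text \<open>
  The positions occupied by the block are all smaller than \<open>M\<close>, so each value in \<open>Z\<close> is an
  excedance.
\<close>
lemma block_wt_above:
  assumes "Y \<subseteq> {..<M}" and "Z \<subseteq> {M..}" and "finite Z"
    and "p + card (Y \<union> Z) \<le> M"
  shows "block_wt t r p (Y \<union> Z) = block_wt t r p Y * t ^ card Z"
proof -
  have finY: "finite Y" using assms(1) finite_subset by blast
  have disj: "Y \<inter> Z = {}" using assms(1,2) by (rule disjoint_below_above)
  have 1: "{y \<in> Y \<union> Z. y < x} = {y \<in> Y. y < x}" if "x \<in> Y" for x
    using that assms(1,2) by (auto simp: subset_iff) (meson less_asym less_le_trans)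
  have 2: "arrow_wt t r (p + card {y \<in> Y \<union> Z. y < x}) x = t" if "x \<in> Z" for x
  proof -
    have "card {y \<in> Y \<union> Z. y < x} < card (Y \<union> Z)"
      using that finY assms(3) by (intro psubset_card_mono) auto
    moreover have "M \<le> x" using that assms(2) by auto
    ultimately show ?thesis using assms(4) by (simp add: arrow_wt_def)
  qed
  have "block_wt t r p (Y \<union> Z) =
      (\<Prod>x\<in>Y. arrow_wt t r (p + card {y \<in> Y \<union> Z. y < x}) x) *
      (\<Prod>x\<in>Z. arrow_wt t r (p + card {y \<in> Y \<union> Z. y < x}) x)"
    unfolding block_wt_def by (rule prod.union_disjoint[OF finY assms(3) disj])
  also have "\<dots> = block_wt t r p Y * t ^ card Z"
    using 1 2 by (simp add: block_wt_def)
  finally show ?thesis .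
qed

text \<open>
  Consider a block of \<open>m\<close> positions starting at \<open>N\<close>, in which \<open>d\<close> values below \<open>N\<close> come first. A value
  \<open>v\<close> of the block with \<open>N \<le> v < N + m\<close> is an excedance, a fixed point or neither according to
  whether the number \<open>g\<close> of values in \<open>[N, v)\<close> that are missing from the block is greater than, equal
  to or less than \<open>d\<close>. If \<open>f\<close> of the \<open>m\<close> values are missing, the block values are distributed over
  \<open>f + 1\<close> gaps, and the gap behind the \<open>g\<close>-th missing value contributes a geometric series.
\<close>
definition gap_series :: "'a \<Rightarrow> 'a \<Rightarrow> nat \<Rightarrow> nat \<Rightarrow> 'a::field fps" where
  "gap_series t r d f =
     fps_X ^ f * (\<Prod>g\<le>f. inverse (1 - fps_const (if g < d then 1 else if g = d then r else t) * fps_X))"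

lemma gap_series_Suc_nth:
  "gap_series t r d f $ Suc m =
     (if f = 0 then 0 else gap_series t r d (f - 1) $ m)
     + (if f < d then 1 else if f = d then r else t) * gap_series t r d f $ m"
proof -
  let ?c = "if f < d then 1 else if f = d then r else t"
  let ?P = "1 - fps_const ?c * fps_X"
  have inv: "inverse ?P * ?P = 1"
    by (rule inverse_mult_eq_1) simp
  define B where "B = (if f = 0 then 1 else fps_X * gap_series t r d (f - 1))"
  have "gap_series t r d f = B * inverse ?P"
    by (cases f) (simp_all add: gap_series_def B_def mult_ac)
  then have "gap_series t r d f * ?P = B"
    using inv by (simp add: mult.assoc)
  then have "gap_series t r d f = B + fps_const ?c * (fps_X * gap_series t r d f)"
    by (simp add: algebra_simps)
  then have "gap_series t r d f $ Suc m = (B + fps_const ?c * (fps_X * gap_series t r d f)) $ Suc m"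
    by simp
  then show ?thesis by (simp add: B_def)
qed

lemma gap_series_nth_0: "gap_series t r d f $ 0 = (if f = 0 then 1 else 0)"
proof (cases f)
  case 0
  have "gap_series t r d 0 $ 0 = 1"
    unfolding gap_series_def atMost_0 by simp
  then show ?thesis using 0 by simp
next
  case (Suc f')
  then show ?thesis by (simp add: gap_series_def mult.assoc)
qed

lemma gap_series_nth_less: "m < f \<Longrightarrow> gap_series t r d f $ m = 0"
  by (simp add: gap_series_def fps_X_power_mult_nth)

text \<open>
  Induction on \<open>m\<close>: the value \<open>N + m\<close> is either missing, which lowers \<open>f\<close>, or it is the last entry
  of the block, with all \<open>f\<close> missing values before it. This is the recurrence for the coefficients of
  the gap series.
\<close>
lemma sum_block_wt_eq_gap_series:
  "(\<Sum>Y | Y \<subseteq> {N..<N + m} \<and> card Y + f = m. block_wt t r (N + d) Y) = gap_series t r d f $ m"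
proof (induction m arbitrary: f)
  case 0
  have "{Y. Y \<subseteq> {N..<N + 0} \<and> card Y + f = 0} = (if f = 0 then {{}} else {})"
    by auto
  then show ?case by (simp add: gap_series_nth_0 block_wt_def)
next
  case (Suc m)
  let ?S = "\<lambda>m f. {Y. Y \<subseteq> {N..<N + m} \<and> card Y + f = m}"
  let ?c = "if f < d then 1 else if f = d then r else t"
  have fin: "finite (?S m f)" for m f
    by (rule finite_subset[of _ "Pow {N..<N + m}"]) auto
  have finY: "finite Y" if "Y \<in> ?S m f" for Y m f
    using that by (auto intro: finite_subset)
  have max: "N + m \<notin> Y" if "Y \<in> ?S m f" for Y f
    using that by auto
  have iv: "{N..<N + Suc m} = insert (N + m) {N..<N + m}" by auto
  have skip: "{Y \<in> ?S (Suc m) f. N + m \<notin> Y} = (if f = 0 then {} else ?S m (f - 1))"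
  proof -
    have "card Y \<le> m" if "Y \<subseteq> {N..<N + m}" for Y
      using card_mono[OF _ that] by simp
    then have "{Y \<in> ?S (Suc m) f. N + m \<notin> Y} = {Y. Y \<subseteq> {N..<N + m} \<and> card Y + f = Suc m \<and> card Y \<le> m}"
      unfolding iv by (auto simp: subset_insert)
    also have "\<dots> = (if f = 0 then {} else ?S m (f - 1))"
      by auto
    finally show ?thesis .
  qed
  have take: "{Y \<in> ?S (Suc m) f. N + m \<in> Y} = insert (N + m) ` ?S m f"
  proof (intro equalityI subsetI)
    fix Y assume Y: "Y \<in> {Y \<in> ?S (Suc m) f. N + m \<in> Y}"
    then have "finite Y" by (auto intro: finite_subset)
    then have "card Y = Suc (card (Y - {N + m}))" using Y by (intro card.remove) auto
    then have "Y - {N + m} \<in> ?S m f"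
      using Y unfolding iv by auto
    moreover have "Y = insert (N + m) (Y - {N + m})" using Y by auto
    ultimately show "Y \<in> insert (N + m) ` ?S m f" by blast
  next
    fix Z assume "Z \<in> insert (N + m) ` ?S m f"
    then obtain Y where Y: "Y \<in> ?S m f" and Z: "Z = insert (N + m) Y" by blast
    have "card Z = Suc (card Y)"
      unfolding Z by (rule card_insert_disjoint[OF finY[OF Y] max[OF Y]])
    moreover have "Z \<subseteq> insert (N + m) {N..<N + m}" using Y Z by blast
    ultimately show "Z \<in> {Y \<in> ?S (Suc m) f. N + m \<in> Y}"
      unfolding iv using Y Z by simp
  qed
  have wt: "block_wt t r (N + d) (insert (N + m) Y) = block_wt t r (N + d) Y * ?c"
    if "Y \<in> ?S m f" for Y
  proof -
    have Y: "Y \<subseteq> {N..<N + m}" "card Y + f = m" using that by auto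
    have "{y \<in> insert (N + m) Y. y < x} = {y \<in> Y. y < x}" if "x \<in> Y" for x
    proof -
      have "x < N + m" using that Y(1) by auto
      then show ?thesis by auto
    qed
    moreover have "{y \<in> insert (N + m) Y. y < N + m} = Y"
      using Y(1) by auto
    moreover have "arrow_wt t r (N + d + card Y) (N + m) = ?c"
      using Y(2) by (auto simp: arrow_wt_def)
    ultimately show ?thesis
      using max[OF that] finY[OF that] by (simp add: block_wt_def mult.commute)
  qed
  have inj: "inj_on (insert (N + m)) (?S m f)"
    using max by (intro inj_onI) (metis insert_ident)
  have "(\<Sum>Y\<in>?S (Suc m) f. block_wt t r (N + d) Y) =
      (\<Sum>Y\<in>{Y \<in> ?S (Suc m) f. N + m \<notin> Y}. block_wt t r (N + d) Y)
      + (\<Sum>Y\<in>{Y \<in> ?S (Suc m) f. N + m \<in> Y}. block_wt t r (N + d) Y)"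
    by (subst sum.union_disjoint[symmetric]) (use fin in \<open>auto intro!: sum.cong\<close>)
  also have "(\<Sum>Y\<in>{Y \<in> ?S (Suc m) f. N + m \<notin> Y}. block_wt t r (N + d) Y) =
      (if f = 0 then 0 else gap_series t r d (f - 1) $ m)"
    unfolding skip by (cases "f = 0") (simp_all only: Suc.IH simp_thms if_True if_False sum.empty)
  also have "(\<Sum>Y\<in>{Y \<in> ?S (Suc m) f. N + m \<in> Y}. block_wt t r (N + d) Y) =
      (\<Sum>Y\<in>?S m f. block_wt t r (N + d) Y * ?c)"
    unfolding take using wt by (simp add: sum.reindex[OF inj])
  also have "\<dots> = ?c * gap_series t r d f $ m"
    by (simp add: sum_distrib_right[symmetric] Suc.IH mult.commute)
  finally show ?case
    by (simp only: gap_series_Suc_nth)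
qed

section \<open>The recurrence for open permutations\<close>

text \<open>
  The final block has \<open>m\<close> entries, and the whole word has \<open>k\<close> up values. Of the entries in the block,
  \<open>d\<close> are below \<open>N\<close> and \<open>e\<close> are up values of the whole word. The other \<open>k - e\<close> up values belong to
  the prefix, as do \<open>i\<close> of the \<open>d + e\<close> values in \<open>[N, N + m)\<close> that are missing from the block; so the
  prefix has \<open>k - e + i\<close> up values, and leaves equally many values below \<open>N\<close> from which the \<open>d\<close> are
  chosen.
\<close>
definition block_kernel :: "'a \<Rightarrow> 'a \<Rightarrow> nat \<Rightarrow> nat \<Rightarrow> (nat \<Rightarrow> 'a) \<Rightarrow> 'a::field" where
  "block_kernel t r m k s =
     (\<Sum>d\<le>m. \<Sum>e\<le>k. of_nat (k choose e) * t ^ e * gap_series t r d (d + e) $ m *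
        (\<Sum>i\<le>d + e. of_nat (d + e choose i) * (of_nat (k - e + i choose d) * s (k - e + i))))"

text \<open>
  The value set of the block is split at \<open>N\<close>. The part below \<open>N\<close> is any set of values not used by the
  prefix, of which there are \<open>card V\<close>, and only its cardinality \<open>d\<close> influences the weight.
\<close>
lemma sum_final_block_sets:
  fixes t r :: "'a::field"
  assumes ys: "ys \<in> open_perms N V" and V: "V \<subseteq> {N..<N + m + k}"
  shows "(\<Sum>X | X \<subseteq> {..<N + m + k} - set ys \<and> card X = m \<and> {N + m..<N + m + k} \<subseteq> V \<union> X.
            block_wt t r N X) =
         (\<Sum>d\<le>m. of_nat (card V choose d) *
            (\<Sum>Y | Y \<subseteq> {N..<N + m + k} - V \<and> card Y + d = m \<and> {N + m..<N + m + k} \<subseteq> V \<union> Y.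
              block_wt t r (N + d) Y))"
proof -
  let ?T = "{N + m..<N + m + k}"
  let ?A = "{..<N} - set ys" and ?B = "{N..<N + m + k} - V"
  have finV: "finite V" using V finite_subset by blast
  have AB: "{..<N + m + k} - set ys = ?A \<union> ?B"
  proof -
    have "set ys \<inter> {N..} = V" using ys V by (auto simp: open_perms_def)
    then show ?thesis by auto
  qed
  have cardA: "card ?A = card V"
  proof -
    have "set ys = (set ys \<inter> {..<N}) \<union> V" "(set ys \<inter> {..<N}) \<inter> V = {}"
      using ys V by (auto simp: open_perms_def)
    then have "card (set ys) = card (set ys \<inter> {..<N}) + card V"
      using finV by (metis card_Un_disjoint finite_Int finite_lessThan)
    moreover have "card (set ys) = N"
      using ys by (simp add: open_perms_def distinct_card)
    moreover have "card ?A = N - card (set ys \<inter> {..<N})"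
      by (simp add: card_Diff_subset_Int Int_commute)
    ultimately show ?thesis by simp
  qed
  define g where "g d = (\<Sum>Y\<in>Pow ?B. if card Y + d = m \<and> ?T \<subseteq> V \<union> Y then block_wt t r (N + d) Y else 0)" for d
  have "(\<Sum>X | X \<subseteq> {..<N + m + k} - set ys \<and> card X = m \<and> ?T \<subseteq> V \<union> X. block_wt t r N X) =
      (\<Sum>X\<in>Pow (?A \<union> ?B). if card X = m \<and> ?T \<subseteq> V \<union> X then block_wt t r N X else 0)"
    unfolding AB by (subst sum.inter_filter[symmetric]) (auto intro: sum.cong)
  also have "\<dots> = (\<Sum>L\<in>Pow ?A. \<Sum>Y\<in>Pow ?B.
      if card (L \<union> Y) = m \<and> ?T \<subseteq> V \<union> (L \<union> Y) then block_wt t r N (L \<union> Y) else 0)"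
    by (rule sum_Pow_Un) auto
  also have "\<dots> = (\<Sum>L\<in>Pow ?A. g (card L))"
    unfolding g_def
  proof (intro sum.cong refl)
    fix L Y assume L: "L \<in> Pow ?A" and Y: "Y \<in> Pow ?B"
    have fin: "finite L" "finite Y" using L Y by (auto intro: finite_subset)
    have "L \<inter> Y = {}" using L Y by (intro disjoint_below_above[of _ N]) auto
    then have "card (L \<union> Y) = card Y + card L" using fin by (simp add: card_Un_disjoint)
    moreover have "?T \<subseteq> V \<union> (L \<union> Y) \<longleftrightarrow> ?T \<subseteq> V \<union> Y"
      using disjoint_below_above[of L N ?T] L by auto
    moreover have "block_wt t r N (L \<union> Y) = block_wt t r (N + card L) Y"
      using L Y fin by (intro block_wt_low_high) auto
    ultimately show "(if card (L \<union> Y) = m \<and> ?T \<subseteq> V \<union> (L \<union> Y) then block_wt t r N (L \<union> Y) else 0) =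
        (if card Y + card L = m \<and> ?T \<subseteq> V \<union> Y then block_wt t r (N + card L) Y else 0)"
      by simp
  qed
  also have "\<dots> = (\<Sum>d\<le>card V. of_nat (card V choose d) * g d)"
    using sum_Pow_card[of ?A g] cardA by simp
  also have "\<dots> = (\<Sum>d\<le>max m (card V). of_nat (card V choose d) * g d)"
    by (rule sum.mono_neutral_left) (auto simp: not_le binomial_eq_0)
  also have "\<dots> = (\<Sum>d\<le>m. of_nat (card V choose d) * g d)"
    by (rule sum.mono_neutral_right) (auto simp: g_def)
  also have "\<dots> = (\<Sum>d\<le>m. of_nat (card V choose d) *
      (\<Sum>Y | Y \<subseteq> ?B \<and> card Y + d = m \<and> ?T \<subseteq> V \<union> Y. block_wt t r (N + d) Y))"
    unfolding g_def by (subst sum.inter_filter[symmetric]) (auto intro!: sum.cong)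
  finally show ?thesis .
qed

lemma sum_Pow_supersets:
  fixes h :: "nat \<Rightarrow> 'a::field"
  assumes "finite A" and "finite B" and "A \<inter> B = {}"
  shows "(\<Sum>V\<in>Pow (A \<union> B). if B \<subseteq> V then h (card V) else 0) =
         (\<Sum>i\<le>card A. of_nat (card A choose i) * h (card B + i))"
proof -
  have "(\<Sum>V\<in>Pow (A \<union> B). if B \<subseteq> V then h (card V) else 0) =
      (\<Sum>V\<in>Pow A. \<Sum>Z\<in>Pow B. if B \<subseteq> V \<union> Z then h (card (V \<union> Z)) else 0)"
    by (rule sum_Pow_Un) (use assms in auto)
  also have "\<dots> = (\<Sum>V\<in>Pow A. \<Sum>Z\<in>Pow B. if Z = B then h (card B + card V) else 0)"
  proof (intro sum.cong refl)
    fix V Z assume VZ: "V \<in> Pow A" "Z \<in> Pow B"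
    then have "B \<subseteq> V \<union> Z \<longleftrightarrow> Z = B" using assms by auto
    moreover have "card (V \<union> B) = card B + card V"
      using assms VZ finite_subset[of V A] by (subst card_Un_disjoint) auto
    ultimately show "(if B \<subseteq> V \<union> Z then h (card (V \<union> Z)) else 0) =
        (if Z = B then h (card B + card V) else 0)" by simp
  qed
  also have "\<dots> = (\<Sum>V\<in>Pow A. h (card B + card V))"
    using assms by simp
  also have "\<dots> = (\<Sum>i\<le>card A. of_nat (card A choose i) * h (card B + i))"
    by (rule sum_Pow_card[OF \<open>finite A\<close>])
  finally show ?thesis .
qed

text \<open>
  For a fixed part \<open>Y\<close> of the block above \<open>N\<close>, the set \<open>V\<close> of up values of the prefix consists of all of
  \<open>[N + m, N + m + k) - Y\<close> and an arbitrary subset of \<open>[N, N + m) - Y\<close>. Hence the sum over \<open>V\<close> depends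
  on the cardinalities of the two parts of \<open>Y\<close> alone, and the sum over \<open>Y\<close> factors.
\<close>
lemma sum_final_block_eq_kernel:
  fixes t r :: "'a::field"
  shows "(\<Sum>V\<in>Pow {N..<N + m + k}. s (card V) *
      (\<Sum>d\<le>m. of_nat (card V choose d) *
        (\<Sum>Y | Y \<subseteq> {N..<N + m + k} - V \<and> card Y + d = m \<and> {N + m..<N + m + k} \<subseteq> V \<union> Y.
          block_wt t r (N + d) Y))) = block_kernel t r m k s"
  (is "?L = _")
proof -
  let ?M = "{N..<N + m}" and ?T = "{N + m..<N + m + k}" and ?U = "{N..<N + m + k}"
  have U: "?U = ?T \<union> ?M" by auto
  define h where "h d j = of_nat (j choose d) * s j" for d j
  define W where "W d f e = (\<Sum>i\<le>f. of_nat (f choose i) * h d (k - e + i))" for d f e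
  have inner: "(\<Sum>V\<in>Pow (?U - Y). if ?T \<subseteq> V \<union> Y then h d (card V) else 0) =
      W d (card (?M - Y)) (card (?T \<inter> Y))" for d Y
  proof -
    have "?U - Y = (?M - Y) \<union> (?T - Y)" by auto
    moreover have "?T \<subseteq> V \<union> Y \<longleftrightarrow> ?T - Y \<subseteq> V" for V by auto
    moreover have "card (?T - Y) = k - card (?T \<inter> Y)"
      by (simp add: card_Diff_subset_Int)
    moreover have "(\<Sum>V\<in>Pow ((?M - Y) \<union> (?T - Y)). if ?T - Y \<subseteq> V then h d (card V) else 0) =
        (\<Sum>i\<le>card (?M - Y). of_nat (card (?M - Y) choose i) * h d (card (?T - Y) + i))"
      by (rule sum_Pow_supersets) auto
    ultimately show ?thesis by (simp add: W_def)
  qed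
  have "?L = (\<Sum>V\<in>Pow ?U. \<Sum>d\<le>m. \<Sum>Y\<in>Pow ?U.
      if Y \<subseteq> ?U - V \<and> card Y + d = m \<and> ?T \<subseteq> V \<union> Y then block_wt t r (N + d) Y * h d (card V) else 0)"
  proof (rule sum.cong[OF refl], unfold sum_distrib_left, rule sum.cong[OF refl], goal_cases)
    case (1 V d)
    have "{Y. Y \<subseteq> ?U - V \<and> card Y + d = m \<and> ?T \<subseteq> V \<union> Y} =
        {Y \<in> Pow ?U. Y \<subseteq> ?U - V \<and> card Y + d = m \<and> ?T \<subseteq> V \<union> Y}" by auto
    then have "(\<Sum>Y | Y \<subseteq> ?U - V \<and> card Y + d = m \<and> ?T \<subseteq> V \<union> Y.
          s (card V) * (of_nat (card V choose d) * block_wt t r (N + d) Y)) =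
        (\<Sum>Y\<in>Pow ?U. if Y \<subseteq> ?U - V \<and> card Y + d = m \<and> ?T \<subseteq> V \<union> Y
          then s (card V) * (of_nat (card V choose d) * block_wt t r (N + d) Y) else 0)"
      by (simp only: sum.inter_filter finite_Pow_iff finite_atLeastLessThan)
    then show ?case
      by (simp only: h_def mult_ac)
  qed
  also have "\<dots> = (\<Sum>d\<le>m. \<Sum>V\<in>Pow ?U. \<Sum>Y\<in>Pow ?U.
      if Y \<subseteq> ?U - V \<and> card Y + d = m \<and> ?T \<subseteq> V \<union> Y then block_wt t r (N + d) Y * h d (card V) else 0)"
    by (rule sum.swap)
  also have "\<dots> = (\<Sum>d\<le>m. \<Sum>Y\<in>Pow ?U. \<Sum>V\<in>Pow ?U.
      if Y \<subseteq> ?U - V \<and> card Y + d = m \<and> ?T \<subseteq> V \<union> Y then block_wt t r (N + d) Y * h d (card V) else 0)"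
    by (intro sum.cong refl sum.swap)
  also have "\<dots> = (\<Sum>d\<le>m. \<Sum>Y\<in>Pow ?U. if card Y + d = m then
      block_wt t r (N + d) Y * W d (card (?M - Y)) (card (?T \<inter> Y)) else 0)"
  proof (intro sum.cong refl, goal_cases)
    case (1 d Y)
    have "(\<Sum>V\<in>Pow ?U. if Y \<subseteq> ?U - V \<and> card Y + d = m \<and> ?T \<subseteq> V \<union> Y
          then block_wt t r (N + d) Y * h d (card V) else 0) =
        (\<Sum>V\<in>Pow (?U - Y). if card Y + d = m
          then block_wt t r (N + d) Y * (if ?T \<subseteq> V \<union> Y then h d (card V) else 0) else 0)"
      using 1 by (intro sum.mono_neutral_cong_right) auto
    also have "\<dots> = (if card Y + d = m then block_wt t r (N + d) Y *
          (\<Sum>V\<in>Pow (?U - Y). if ?T \<subseteq> V \<union> Y then h d (card V) else 0) else 0)"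
      by (simp add: sum_distrib_left)
    finally show ?case unfolding inner .
  qed
  also have "\<dots> = (\<Sum>d\<le>m. \<Sum>Z\<in>Pow ?T. t ^ card Z * gap_series t r d (d + card Z) $ m *
      W d (d + card Z) (card Z))"
  proof (rule sum.cong[OF refl])
    fix d
    have "(\<Sum>Y\<in>Pow ?U. if card Y + d = m then
        block_wt t r (N + d) Y * W d (card (?M - Y)) (card (?T \<inter> Y)) else 0) =
      (\<Sum>Z\<in>Pow ?T. \<Sum>Y\<in>Pow ?M. if card (Z \<union> Y) + d = m then
        block_wt t r (N + d) (Z \<union> Y) * W d (card (?M - (Z \<union> Y))) (card (?T \<inter> (Z \<union> Y))) else 0)"
      unfolding U by (rule sum_Pow_Un) auto
    also have "\<dots> = (\<Sum>Z\<in>Pow ?T. \<Sum>Y\<in>Pow ?M. if card Y + (d + card Z) = m then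
        block_wt t r (N + d) Y * t ^ card Z * W d (d + card Z) (card Z) else 0)"
    proof (intro sum.cong refl, goal_cases)
      case (1 Z Y)
      have sub: "Z \<subseteq> ?T" "Y \<subseteq> ?M" using 1 by auto
      have fin: "finite Z" "finite Y" using sub by (auto intro: finite_subset)
      have disj: "Y \<inter> Z = {}"
        using sub by (intro disjoint_below_above[of _ "N + m"]) auto
      have card: "card (Z \<union> Y) = card Y + card Z"
        using fin disj by (metis Un_commute card_Un_disjoint)
      have sets: "?M - (Z \<union> Y) = ?M - Y" "?T \<inter> (Z \<union> Y) = Z"
        using sub by (auto simp: subset_iff)
      have "card (?M - Y) = m - card Y"
        using sub fin by (simp add: card_Diff_subset)
      moreover have "block_wt t r (N + d) (Z \<union> Y) = block_wt t r (N + d) Y * t ^ card Z"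
        if "card Y + (d + card Z) = m"
        unfolding Un_commute[of Z Y]
        by (rule block_wt_above[of _ "N + m"])
           (use sub fin that card in \<open>auto simp: Un_commute\<close>)
      ultimately show ?case
        unfolding card sets by auto
    qed
    also have "\<dots> = (\<Sum>Z\<in>Pow ?T. \<Sum>Y | Y \<subseteq> ?M \<and> card Y + (d + card Z) = m.
        block_wt t r (N + d) Y * t ^ card Z * W d (d + card Z) (card Z))"
      by (subst sum.inter_filter[symmetric]) (auto intro!: sum.cong)
    also have "\<dots> = (\<Sum>Z\<in>Pow ?T. t ^ card Z * gap_series t r d (d + card Z) $ m *
        W d (d + card Z) (card Z))"
      by (simp only: sum_distrib_right[symmetric] sum_block_wt_eq_gap_series) (simp only: mult_ac)
    finally show "(\<Sum>Y\<in>Pow ?U. if card Y + d = m then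
        block_wt t r (N + d) Y * W d (card (?M - Y)) (card (?T \<inter> Y)) else 0) =
      (\<Sum>Z\<in>Pow ?T. t ^ card Z * gap_series t r d (d + card Z) $ m * W d (d + card Z) (card Z))" .
  qed
  also have "\<dots> = (\<Sum>d\<le>m. \<Sum>e\<le>k. of_nat (k choose e) *
      (t ^ e * gap_series t r d (d + e) $ m * W d (d + e) e))"
    by (intro sum.cong refl)
       (use sum_Pow_card[of ?T "\<lambda>e. t ^ e * gap_series t r _ (_ + e) $ m * W _ (_ + e) e"] in simp)
  also have "\<dots> = block_kernel t r m k s"
    by (simp add: block_kernel_def W_def h_def mult.assoc)
  finally show ?thesis .
qed

lemma block_kernel_mult:
  "block_kernel t r m k (\<lambda>j. c * s j) = c * block_kernel t r m k s"
  by (simp add: block_kernel_def sum_distrib_left mult_ac)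

text \<open>
  The factor \<open>q\<^sup>N\<close> comes from the cut, and amounts to replacing \<open>z\<close> by \<open>qz\<close> in the generating
  functions.
\<close>
lemma open_sum_recurrence:
  fixes q t r :: "'a::field"
  assumes nz: "\<And>n. qpoch q n \<noteq> 0"
  shows "open_sum q t r n {n..<n + k} / qpoch q n =
    (\<Sum>N\<le>n. q ^ N * block_kernel t r (n - N) k (\<lambda>j. open_sum q t r N {N..<N + j} / qpoch q N))"
proof -
  let ?P = "open_perms n {n..<n + k}"
  have "open_sum q t r n {n..<n + k} / qpoch q n =
      (\<Sum>xs\<in>?P. q ^ list_maj xs / qpoch q (length xs) * list_wt t r xs)"
    by (auto simp: open_sum_def sum_divide_distrib open_perms_def intro!: sum.cong)
  also have "\<dots> = (\<Sum>xs\<in>?P. \<Sum>N\<le>n. if sorted (drop N xs)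
      then q ^ N / qpoch q N * (q ^ list_maj (take N xs) * list_wt t r xs) else 0)"
  proof (intro sum.cong refl)
    fix xs assume xs: "xs \<in> ?P"
    then have "distinct xs" "length xs = n" by (auto simp: open_perms_def)
    then have "q ^ list_maj xs / qpoch q (length xs) =
        (\<Sum>N\<in>{N \<in> {..n}. sorted (drop N xs)}. q ^ N * q ^ list_maj (take N xs) / qpoch q N)"
      using maj_over_qpoch_eq_sum_final_blocks[OF nz, of xs] by simp
    also have "\<dots> = (\<Sum>N\<le>n. if sorted (drop N xs)
        then q ^ N * q ^ list_maj (take N xs) / qpoch q N else 0)"
      by (rule sum.inter_filter) simp
    finally show "q ^ list_maj xs / qpoch q (length xs) * list_wt t r xs =
        (\<Sum>N\<le>n. if sorted (drop N xs)
          then q ^ N / qpoch q N * (q ^ list_maj (take N xs) * list_wt t r xs) else 0)"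
      by (auto simp: sum_distrib_right intro!: sum.cong)
  qed
  also have "\<dots> = (\<Sum>N\<le>n. q ^ N / qpoch q N *
      (\<Sum>xs | xs \<in> ?P \<and> sorted (drop N xs). q ^ list_maj (take N xs) * list_wt t r xs))"
    by (subst sum.swap) (auto simp: sum.inter_filter sum_distrib_left intro!: sum.cong)
  also have "\<dots> = (\<Sum>N\<le>n. q ^ N * block_kernel t r (n - N) k
      (\<lambda>j. open_sum q t r N {N..<N + j} / qpoch q N))"
  proof (rule sum.cong[OF refl])
    fix N assume "N \<in> {..n}"
    then obtain m where n: "n = N + m" by (auto simp: le_iff_add)
    have "(\<Sum>xs | xs \<in> ?P \<and> sorted (drop N xs). q ^ list_maj (take N xs) * list_wt t r xs) =
        (\<Sum>V\<in>Pow {N..<N + m + k}. open_sum q t r N V *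
          (\<Sum>d\<le>m. of_nat (card V choose d) *
            (\<Sum>Y | Y \<subseteq> {N..<N + m + k} - V \<and> card Y + d = m \<and> {N + m..<N + m + k} \<subseteq> V \<union> Y.
              block_wt t r (N + d) Y)))"
      unfolding n sum_final_block open_sum_def sum_distrib_right
      by (intro sum.cong refl) (simp add: sum_final_block_sets)
    also have "\<dots> = (\<Sum>V\<in>Pow {N..<N + m + k}. open_sum q t r N {N..<N + card V} *
          (\<Sum>d\<le>m. of_nat (card V choose d) *
            (\<Sum>Y | Y \<subseteq> {N..<N + m + k} - V \<and> card Y + d = m \<and> {N + m..<N + m + k} \<subseteq> V \<union> Y.
              block_wt t r (N + d) Y)))"
    proof (intro sum.cong refl, goal_cases)
      case (1 V)
      then have "finite V" "V \<subseteq> {N..}" by (auto intro: finite_subset)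
      then show ?case using open_sum_relabel[of V N q t r] by simp
    qed
    also have "\<dots> = block_kernel t r m k (\<lambda>j. open_sum q t r N {N..<N + j})"
      by (rule sum_final_block_eq_kernel)
    finally show "q ^ N / qpoch q N *
        (\<Sum>xs | xs \<in> ?P \<and> sorted (drop N xs). q ^ list_maj (take N xs) * list_wt t r xs) =
      q ^ N * block_kernel t r (n - N) k (\<lambda>j. open_sum q t r N {N..<N + j} / qpoch q N)"
      using block_kernel_mult[of t r m k "1 / qpoch q N" "\<lambda>j. open_sum q t r N {N..<N + j}"]
      by (simp add: n)
  qed
  finally show ?thesis .
qed

section \<open>Sums of diagonal coefficients\<close>

lemma unit_mult_eqD:
  fixes x y z w :: "'a::comm_monoid_mult"
  assumes "x * y = 1" and "x * z = w"
  shows "z = y * w"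
proof -
  have "z = (x * y) * z" using assms(1) by simp
  also have "\<dots> = y * (x * z)" by (simp only: mult_ac)
  finally show ?thesis using assms(2) by simp
qed

text \<open>
  Every coefficient of \<open>(a + bh)\<^sup>d\<close> has order at least \<open>d\<close>. Thus the infinite sums over \<open>d\<close> below can
  be truncated at \<open>d = n\<close> when only the coefficient of \<open>z\<^sup>n\<close> matters.
\<close>
lemma coeff_linear_power_mult_nth_eq_0:
  fixes a b :: "'a::field fps"
  assumes "a $ 0 = 0" "b $ 0 = 0" and "n < d"
  shows "coeff ([:a, b:] ^ d * p) i $ n = 0"
  using \<open>n < d\<close>
proof (induction d arbitrary: n i)
  case (Suc d)
  have *: "(c * coeff ([:a, b:] ^ d * p) j) $ n = 0" if "c $ 0 = 0" for c j
    unfolding fps_mult_nth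
  proof (rule sum.neutral, rule ballI)
    fix l assume "l \<in> {0..n}"
    then show "c $ l * coeff ([:a, b:] ^ d * p) j $ (n - l) = 0"
      using that Suc by (cases "l = 0") auto
  qed
  have X: "[:a, b:] * p' = smult a p' + pCons 0 (smult b p')" for p'
    by simp
  have "[:a, b:] ^ Suc d * p = smult a ([:a, b:] ^ d * p) + pCons 0 (smult b ([:a, b:] ^ d * p))"
    unfolding power_Suc mult.assoc by (rule X)
  then show ?case
    using *[of a] *[of b] assms by (simp add: coeff_pCons split: nat.split)
qed simp

text \<open>
  Let \<open>Q(p)\<close> be the sum over all \<open>d\<close> of the coefficient of \<open>h\<^sup>d\<close> in \<open>(a + bh)\<^sup>d p(h)\<close>, which is
  linear in \<open>p\<close>. Shifting \<open>d\<close> by one gives \<open>Q((a + bh) p) = Q(h p)\<close>, that is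
  \<open>Q(h p) = a/(1-b) Q(p)\<close>. Hence multiplication by \<open>h\<close> acts as multiplication by the scalar
  \<open>a/(1-b)\<close>, and \<open>Q(1) = \<Sum>\<^sub>d b\<^sup>d = 1/(1-b)\<close>.
\<close>
lemma sum_diagonal_coeffs:
  fixes a b :: "'a::field fps"
  assumes a: "a $ 0 = 0" and b: "b $ 0 = 0"
  shows "(\<Sum>d\<le>n. coeff ([:a, b:] ^ d * p) d $ n) =
         (poly p (a * inverse (1 - b)) * inverse (1 - b)) $ n"
proof -
  define Q where "Q p = Abs_fps (\<lambda>n. \<Sum>d\<le>n. coeff ([:a, b:] ^ d * p) d $ n)" for p
  note vanish = coeff_linear_power_mult_nth_eq_0[OF a b]
  \<comment> \<open>Any truncation beyond \<open>n\<close> gives the same coefficient, which justifies the shift of \<open>d\<close>.\<close>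
  have Q_nth: "Q p $ n = (\<Sum>d\<le>M. coeff ([:a, b:] ^ d * p) d $ n)" if "n \<le> M" for p n M
    unfolding Q_def fps_nth_Abs_fps
    by (rule sum.mono_neutral_left) (use that vanish in auto)
  have Q_add: "Q (p + p') = Q p + Q p'" for p p'
    by (simp add: Q_def fps_eq_iff algebra_simps sum.distrib)
  have Q_smult: "Q (smult c p) = c * Q p" for c p
  proof (rule fps_ext)
    fix n
    have "(c * Q p) $ n = (\<Sum>l=0..n. c $ l * (\<Sum>d\<le>n. coeff ([:a, b:] ^ d * p) d $ (n - l)))"
      unfolding fps_mult_nth by (intro sum.cong refl arg_cong2[where f = "(*)"] Q_nth) simp
    also have "\<dots> = (\<Sum>d\<le>n. (c * coeff ([:a, b:] ^ d * p) d) $ n)"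
      unfolding fps_mult_nth sum_distrib_left by (rule sum.swap)
    also have "\<dots> = Q (smult c p) $ n"
      by (simp add: Q_def)
    finally show "Q (smult c p) $ n = (c * Q p) $ n" ..
  qed
  have Q_shift: "Q ([:a, b:] * p) = Q (pCons 0 p)" for p
  proof (rule fps_ext)
    fix n
    have "Q (pCons 0 p) $ n = (\<Sum>d\<le>Suc n. coeff ([:a, b:] ^ d * pCons 0 p) d $ n)"
      by (rule Q_nth) simp
    also have "\<dots> = (\<Sum>d\<le>n. coeff ([:a, b:] ^ Suc d * p) d $ n)"
      by (subst sum.atMost_Suc_shift) simp
    also have "\<dots> = (\<Sum>d\<le>n. coeff ([:a, b:] ^ d * ([:a, b:] * p)) d $ n)"
      by (simp only: power_Suc2 mult.assoc)
    finally show "Q ([:a, b:] * p) $ n = Q (pCons 0 p) $ n"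
      by (simp add: Q_def)
  qed
  have unit: "(1 - b) * inverse (1 - b) = 1"
    using b by (intro inverse_mult_eq_1') simp
  have Q_X: "Q (pCons 0 p) = a * inverse (1 - b) * Q p" for p
  proof -
    have "[:a, b:] * p = smult a p + smult b (pCons 0 p)"
      by simp
    then have "Q (pCons 0 p) = a * Q p + b * Q (pCons 0 p)"
      using Q_shift[of p] by (simp only: Q_add Q_smult)
    then have "(1 - b) * Q (pCons 0 p) = a * Q p"
      by (simp add: algebra_simps)
    from unit_mult_eqD[OF unit this] show ?thesis
      by (simp add: mult_ac)
  qed
  have Q_1: "Q 1 = inverse (1 - b)"
  proof -
    have pow: "coeff ([:a, b:] ^ d) d = b ^ d" for d
      by (simp add: coeff_linear_poly_power)
    have "Q 1 = 1 + b * Q 1"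
    proof (rule fps_ext)
      fix n
      have "Q 1 $ n = (\<Sum>d\<le>Suc n. b ^ d $ n)"
        using Q_nth[of n "Suc n" 1] by (simp add: pow del: sum.atMost_Suc)
      also have "\<dots> = 1 $ n + (\<Sum>d\<le>n. (b * b ^ d) $ n)"
        by (subst sum.atMost_Suc_shift) simp
      also have "(\<Sum>d\<le>n. (b * b ^ d) $ n) = Q (smult b 1) $ n"
        by (simp add: Q_def pow)
      also have "\<dots> = (b * Q 1) $ n" by (simp only: Q_smult)
      finally show "Q 1 $ n = (1 + b * Q 1) $ n" by simp
    qed
    then have "(1 - b) * Q 1 = 1" by (simp add: algebra_simps)
    from unit_mult_eqD[OF unit this] show ?thesis by simp
  qed
  have "Q p = poly p (a * inverse (1 - b)) * inverse (1 - b)"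
  proof (induction p)
    case 0
    show ?case using Q_smult[of 0 0] by simp
  next
    case (pCons c p)
    have "pCons c p = smult c 1 + pCons 0 p" by simp
    then have "Q (pCons c p) = c * Q 1 + a * inverse (1 - b) * Q p"
      by (simp only: Q_add Q_smult Q_X)
    then show ?case
      unfolding Q_1 pCons.IH by (simp add: algebra_simps)
  qed
  then show ?thesis by (simp add: Q_def fps_eq_iff)
qed

section \<open>The kernel on geometric families\<close>

lemma gap_series_eq:
  "gap_series t r d (d + e) =
     inverse (1 - fps_const r * fps_X) * (fps_X * inverse (1 - fps_X)) ^ d *
     (fps_X * inverse (1 - fps_const t * fps_X)) ^ e"
proof (induction e)
  case 0
  have "(\<Prod>g\<le>d. inverse (1 - fps_const (if g < d then 1 else if g = d then r else t) * fps_X)) =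
      inverse (1 - fps_const r * fps_X) * (\<Prod>g<d. inverse (1 - fps_X))"
    by (simp add: lessThan_Suc_atMost[symmetric] mult.commute del: prod_constant)
  then show ?case by (simp add: gap_series_def power_mult_distrib mult_ac)
next
  case (Suc e)
  then show ?case by (simp add: gap_series_def mult_ac)
qed

text \<open>
  The kernel as an operator on sequences of power series. Extending the sum over \<open>d\<close> from
  \<open>n - N\<close> to \<open>n\<close> adds only zero coefficients of gap series.
\<close>
lemma sum_block_kernel_nth:
  "(\<Sum>N\<le>n. block_kernel t r (n - N) k (\<lambda>j. S j $ N)) =
   (\<Sum>d\<le>n. (\<Sum>e\<le>k. of_nat (k choose e) * fps_const (t ^ e) * gap_series t r d (d + e) *
      (\<Sum>i\<le>d + e. of_nat (d + e choose i) * (of_nat (k - e + i choose d) * S (k - e + i)))) $ n)"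
proof -
  let ?c = "\<lambda>e. of_nat (k choose e) * t ^ e"
  let ?T = "\<lambda>d e. \<Sum>i\<le>d + e. of_nat (d + e choose i) * (of_nat (k - e + i choose d) * S (k - e + i))"
  have of_nat_nth: "(of_nat a * f) $ N = of_nat a * f $ N" for a N and f :: "'a fps"
    by (simp flip: fps_of_nat)
  have kernel: "block_kernel t r (n - N) k (\<lambda>j. S j $ N) =
      (\<Sum>d\<le>n. \<Sum>e\<le>k. ?c e * (?T d e $ N * gap_series t r d (d + e) $ (n - N)))" if "N \<le> n" for N
  proof -
    have "block_kernel t r (n - N) k (\<lambda>j. S j $ N) =
        (\<Sum>d\<le>n - N. \<Sum>e\<le>k. ?c e * (?T d e $ N * gap_series t r d (d + e) $ (n - N)))"
      by (simp add: block_kernel_def fps_sum_nth of_nat_nth mult_ac)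
    also have "\<dots> = (\<Sum>d\<le>n. \<Sum>e\<le>k. ?c e * (?T d e $ N * gap_series t r d (d + e) $ (n - N)))"
      by (rule sum.mono_neutral_left) (auto intro!: sum.neutral simp: gap_series_nth_less)
    finally show ?thesis .
  qed
  have "(\<Sum>N\<le>n. block_kernel t r (n - N) k (\<lambda>j. S j $ N)) =
      (\<Sum>N\<le>n. \<Sum>d\<le>n. \<Sum>e\<le>k. ?c e * (?T d e $ N * gap_series t r d (d + e) $ (n - N)))"
    using kernel by simp
  also have "\<dots> = (\<Sum>d\<le>n. \<Sum>N\<le>n. \<Sum>e\<le>k. ?c e * (?T d e $ N * gap_series t r d (d + e) $ (n - N)))"
    by (rule sum.swap)
  also have "\<dots> = (\<Sum>d\<le>n. \<Sum>e\<le>k. \<Sum>N\<le>n. ?c e * (?T d e $ N * gap_series t r d (d + e) $ (n - N)))"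
    by (rule sum.cong[OF refl], rule sum.swap)
  also have "\<dots> = (\<Sum>d\<le>n. \<Sum>e\<le>k. ?c e * (?T d e * gap_series t r d (d + e)) $ n)"
    by (simp only: sum_distrib_left[symmetric] fps_mult_nth atLeast0AtMost)
  also have "\<dots> = (\<Sum>d\<le>n. \<Sum>e\<le>k. (of_nat (k choose e) * fps_const (t ^ e) * gap_series t r d (d + e) * ?T d e) $ n)"
  proof (intro sum.cong refl)
    fix d e
    have c: "of_nat (k choose e) * fps_const (t ^ e) = fps_const (?c e)"
      by (simp flip: fps_of_nat)
    have "of_nat (k choose e) * fps_const (t ^ e) * gap_series t r d (d + e) * ?T d e =
        fps_const (?c e) * (?T d e * gap_series t r d (d + e))"
      unfolding c by (simp only: mult_ac)
    then show "?c e * (?T d e * gap_series t r d (d + e)) $ n =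
        (of_nat (k choose e) * fps_const (t ^ e) * gap_series t r d (d + e) * ?T d e) $ n"
      by (simp only: fps_mult_left_const_nth)
  qed
  finally show ?thesis by (simp add: fps_sum_nth)
qed

lemma coeff_constant_linear_power:
  fixes x :: "'a::comm_ring_1"
  shows "coeff ([:x, x:] ^ j) d = of_nat (j choose d) * x ^ j"
proof (cases "d \<le> j")
  case True
  then show ?thesis by (simp add: coeff_linear_poly_power mult.assoc flip: power_add)
next
  case False
  have "degree ([:x, x:] ^ j) \<le> degree [:x, x:] * j" by (rule degree_power_le)
  also have "\<dots> \<le> j" by simp
  finally show ?thesis using False by (simp add: coeff_eq_0 binomial_eq_0)
qed

text \<open>
  On a geometric family, the factor \<open>(j choose d) L\<^sup>j\<close> is the coefficient of \<open>h\<^sup>d\<close> in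
  \<open>(L (1 + h))\<^sup>j\<close>. With this extra variable, the sums over \<open>i\<close> and \<open>e\<close> become binomial expansions:
  of \<open>(1 + L (1 + h))\<^bsup>d+e\<^esup>\<close> and of a \<open>k\<close>-th power.
\<close>
lemma kernel_summand_eq_diagonal_coeff:
  fixes L G :: "'a::field fps" and t r :: 'a
  defines "u \<equiv> fps_X * inverse (1 - fps_X)"
    and "v \<equiv> fps_const t * (fps_X * inverse (1 - fps_const t * fps_X))"
  shows "(\<Sum>e\<le>k. of_nat (k choose e) * fps_const (t ^ e) * gap_series t r d (d + e) *
      (\<Sum>i\<le>d + e. of_nat (d + e choose i) * (of_nat (k - e + i choose d) * (G * L ^ (k - e + i))))) =
    coeff ([:u * (1 + L), u * L:] ^ d *
      smult (G * inverse (1 - fps_const r * fps_X)) ([:L + v * (1 + L), L + v * L:] ^ k)) d"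
proof -
  let ?A = "[:L, L:]" and ?B = "[:1 + L, L:]" and ?R = "inverse (1 - fps_const r * fps_X)"
  have B: "?B = ?A + 1" by (simp add: one_pCons)
  have inner: "(\<Sum>i\<le>d + e. of_nat (d + e choose i) * (of_nat (k - e + i choose d) * (G * L ^ (k - e + i)))) =
      G * coeff (?B ^ (d + e) * ?A ^ (k - e)) d" for e
  proof -
    have "?B ^ (d + e) = (\<Sum>i\<le>d + e. of_nat (d + e choose i) * ?A ^ i)"
      unfolding B by (simp add: binomial_ring)
    then have "?B ^ (d + e) * ?A ^ (k - e) = (\<Sum>i\<le>d + e. of_nat (d + e choose i) * ?A ^ (k - e + i))"
      by (simp only: sum_distrib_right mult.assoc add.commute[of "k - e"] power_add[of ?A])
    then have "coeff (?B ^ (d + e) * ?A ^ (k - e)) d =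
        (\<Sum>i\<le>d + e. of_nat (d + e choose i) * (of_nat (k - e + i choose d) * L ^ (k - e + i)))"
      by (simp add: coeff_sum coeff_constant_linear_power of_nat_poly)
    then show ?thesis by (simp add: sum_distrib_left mult_ac)
  qed
  have expand: "(\<Sum>e\<le>k. of_nat (k choose e) * smult (c * u ^ d * v ^ e) (B ^ (d + e) * A ^ (k - e))) =
      smult u B ^ d * smult c ((smult v B + A) ^ k)" for A B c
  proof -
    have "smult u B ^ d * smult c ((smult v B + A) ^ k) =
        smult (c * u ^ d) (B ^ d * (\<Sum>e\<le>k. of_nat (k choose e) * smult v B ^ e * A ^ (k - e)))"
      unfolding binomial_ring smult_power
      by (simp only: mult_smult_left mult_smult_right smult_smult)
    also have "\<dots> = (\<Sum>e\<le>k. [:c * u ^ d:] * (B ^ d * (of_nat (k choose e) * smult v B ^ e * A ^ (k - e))))"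
      by (simp only: sum_distrib_left[symmetric]) simp
    also have "\<dots> = (\<Sum>e\<le>k. of_nat (k choose e) * smult (c * u ^ d * v ^ e) (B ^ (d + e) * A ^ (k - e)))"
      by (intro sum.cong refl) (simp add: smult_power power_add mult_ac)
    finally show ?thesis ..
  qed
  have "(\<Sum>e\<le>k. of_nat (k choose e) * fps_const (t ^ e) * gap_series t r d (d + e) *
      (\<Sum>i\<le>d + e. of_nat (d + e choose i) * (of_nat (k - e + i choose d) * (G * L ^ (k - e + i))))) =
    (\<Sum>e\<le>k. coeff (of_nat (k choose e) * smult (G * ?R * u ^ d * v ^ e) (?B ^ (d + e) * ?A ^ (k - e))) d)"
    unfolding inner
    by (intro sum.cong refl)
       (simp add: gap_series_eq u_def v_def power_mult_distrib of_nat_poly fps_const_power[symmetric] mult_ac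
          del: fps_const_power)
  also have "\<dots> = coeff (\<Sum>e\<le>k. of_nat (k choose e) * smult (G * ?R * u ^ d * v ^ e) (?B ^ (d + e) * ?A ^ (k - e))) d"
    by (simp add: coeff_sum)
  also have "(\<Sum>e\<le>k. of_nat (k choose e) * smult (G * ?R * u ^ d * v ^ e) (?B ^ (d + e) * ?A ^ (k - e))) =
      smult u ?B ^ d * smult (G * ?R) ((smult v ?B + ?A) ^ k)"
    by (rule expand)
  also have "smult u ?B = [:u * (1 + L), u * L:]" by simp
  also have "smult v ?B + ?A = [:L + v * (1 + L), L + v * L:]" by (simp add: add.commute)
  finally show ?thesis .
qed

lemma geometric_family_kernel:
  fixes L G :: "'a::field fps" and t r :: 'a
  assumes "L $ 0 = 0"
  defines "u \<equiv> fps_X * inverse (1 - fps_X)"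
    and "v \<equiv> fps_const t * (fps_X * inverse (1 - fps_const t * fps_X))"
  shows "(\<Sum>N\<le>n. block_kernel t r (n - N) k (\<lambda>j. (G * L ^ j) $ N)) =
    (G * inverse (1 - fps_const r * fps_X) *
      (L + v * (1 + L) + (L + v * L) * (u * (1 + L) * inverse (1 - u * L))) ^ k
      * inverse (1 - u * L)) $ n"
proof -
  have "(u * (1 + L)) $ 0 = 0" "(u * L) $ 0 = 0" by (simp_all add: u_def)
  note diagonal = sum_diagonal_coeffs[OF this]
  show ?thesis
    unfolding sum_block_kernel_nth kernel_summand_eq_diagonal_coeff u_def[symmetric] v_def[symmetric]
      diagonal
    by (simp add: mult_ac)
qed

section \<open>Solution of the recurrence\<close>

lemma block_kernel_0: "block_kernel t r 0 k s = s k"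
proof -
  have "of_nat (k choose e) * t ^ e * gap_series t r 0 (0 + e) $ 0 *
      (\<Sum>i\<le>0 + e. of_nat (0 + e choose i) * (of_nat (k - e + i choose 0) * s (k - e + i))) =
      (if e = 0 then s k else 0)" for e
    by (cases "e = 0") (simp_all add: gap_series_nth_0)
  then have "block_kernel t r 0 k s = (\<Sum>d\<in>{0::nat}. \<Sum>e\<le>k. if e = 0 then s k else 0)"
    by (simp only: block_kernel_def atMost_0 sum.insert sum.empty finite.emptyI empty_iff simp_thms)
  then show ?thesis by simp
qed

lemma kernel_recurrence_unique:
  fixes b b' :: "nat \<Rightarrow> nat \<Rightarrow> 'a::field"
  assumes b: "\<And>n k. b n k = (\<Sum>N\<le>n. q ^ N * block_kernel t r (n - N) k (b N))"
    and b': "\<And>n k. b' n k = (\<Sum>N\<le>n. q ^ N * block_kernel t r (n - N) k (b' N))"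
    and init: "b 0 = b' 0" and q: "\<And>n. n > 0 \<Longrightarrow> q ^ n \<noteq> 1"
  shows "b n = b' n"
proof (induction n rule: less_induct)
  case (less n)
  have split: "(1 - q ^ n) * c n k = (\<Sum>N<n. q ^ N * block_kernel t r (n - N) k (c N))"
    if "\<And>n k. c n k = (\<Sum>N\<le>n. q ^ N * block_kernel t r (n - N) k (c N))" for c k
  proof -
    have "c n k = (\<Sum>N<n. q ^ N * block_kernel t r (n - N) k (c N)) + q ^ n * c n k"
      by (subst that) (simp add: lessThan_Suc_atMost[symmetric] block_kernel_0)
    then show ?thesis by (simp add: algebra_simps)
  qed
  show ?case
  proof (cases "n = 0")
    case False
    have "(1 - q ^ n) * b n k = (1 - q ^ n) * b' n k" for k
      unfolding split[OF b] split[OF b'] using less.IH by simp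
    then show ?thesis using q[of n] False by auto
  qed (simp add: init)
qed

text \<open>
  The series \<open>exp\<^sub>q(cz/(1-q))\<close>. Rescaling \<open>z\<close> by \<open>1 - q\<close> replaces the \<open>q\<close>-factorials by the
  products that occur in the recurrence.
\<close>
definition qexp :: "'a \<Rightarrow> 'a \<Rightarrow> 'a::field fps" where
  "qexp q c = Abs_fps (\<lambda>n. c ^ n / qpoch q n)"

lemma qexp_nth_0 [simp]: "qexp q c $ 0 = 1"
  by (simp add: qexp_def)

lemma qexp_dilate:
  assumes "\<And>n. qpoch q n \<noteq> 0"
  shows "qexp q (c * q) = (1 - fps_const c * fps_X) * qexp q c"
proof (rule fps_ext)
  fix n
  show "qexp q (c * q) $ n = ((1 - fps_const c * fps_X) * qexp q c) $ n"
  proof (cases n)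
    case (Suc m)
    have "c ^ m / qpoch q m = c ^ m * (1 - q ^ Suc m) / qpoch q (Suc m)"
      using assms[of m] assms[of "Suc m"] by (simp add: qpoch_Suc)
    then show ?thesis
      using assms[of "Suc m"]
      by (simp add: Suc qexp_def left_diff_distrib mult.assoc power_mult_distrib)
         (simp add: field_simps)
  qed simp
qed

lemma qexp_compose_linear: "qexp q c oo (fps_const a * fps_X) = qexp q (c * a)"
  unfolding fps_compose_linear qexp_def
  by (simp add: fps_eq_iff power_mult_distrib mult.commute)

text \<open>
  The denominator of the generating function, rescaled and divided by its constant term.
\<close>
definition denom :: "'a \<Rightarrow> 'a \<Rightarrow> 'a::field fps" where
  "denom q t = fps_const (inverse (1 - t * q)) * (qexp q (t * q) - fps_const (t * q) * qexp q 1)"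

lemma denom_nth_0: "t * q \<noteq> 1 \<Longrightarrow> denom q t $ 0 = 1"
  by (simp add: denom_def)

lemma denom_dilate:
  assumes nz: "\<And>n. qpoch q n \<noteq> 0" and tq: "t * q \<noteq> 1"
  shows "(1 - fps_X) * denom q t =
    (denom q t oo (fps_const q * fps_X)) - fps_X * qexp q (t * q)"
proof -
  let ?k = "fps_const (inverse (1 - t * q))"
  have k: "?k * (1 - fps_const (t * q)) = 1"
    using tq by (simp flip: fps_const_1_eq_1 del: fps_const_1_eq_1)
  have q1: "qexp q q = (1 - fps_X) * qexp q 1"
    using qexp_dilate[OF nz, of 1] by simp
  have Dq: "denom q t oo (fps_const q * fps_X) =
      ?k * (qexp q (t * q * q) - fps_const (t * q) * qexp q q)"
    by (simp add: denom_def fps_compose_mult_distrib fps_compose_sub_distrib qexp_compose_linear)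
  have "(denom q t oo (fps_const q * fps_X)) - (1 - fps_X) * denom q t =
      ?k * (1 - fps_const (t * q)) * (fps_X * qexp q (t * q))"
    unfolding Dq
    unfolding q1 qexp_dilate[OF nz, of "t * q"] denom_def
    by (simp only: algebra_simps mult_1_left mult_1_right)
  then show ?thesis unfolding k by (simp add: algebra_simps)
qed

lemma open_sum_0: "open_sum q t r 0 {0..<k} = (if k = 0 then 1 else 0)"
proof -
  have "open_perms 0 {0..<k} = (if k = 0 then {[]} else {})"
    by (auto simp: open_perms_def)
  then show ?thesis by (simp add: open_sum_def list_maj_def list_wt_def)
qed

text \<open>
  With \<open>F\<close>, \<open>L\<close>, \<open>u\<close>, \<open>v\<close> and \<open>h\<close> as in the proof, the family \<open>F L\<^sup>k\<close> satisfies the recurrence: if \<open>Lq\<close> and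
  \<open>Fq\<close> are the series at \<open>qz\<close>, the kernel produces the ratio
  \<open>Lq (1 + h) + v (1 + Lq (1 + h))\<close> and the prefactor \<open>Fq / ((1 - rz)(1 - u Lq))\<close>. These are \<open>L\<close> and
  \<open>F\<close> because \<open>1 - u Lq = D(z)/D(qz)\<close> and \<open>1 + h = D(qz)/((1 - z) D(z))\<close>, both by the dilation
  rule for \<open>D\<close>.
\<close>
lemma open_sum_eq_series:
  fixes q t r :: "'a::field"
  assumes nz: "\<And>n. qpoch q n \<noteq> 0" and tq: "t * q \<noteq> 1"
  shows "open_sum q t r n {n..<n + k} / qpoch q n =
    (qexp q r * inverse (denom q t) * ((qexp q t - denom q t) * inverse (denom q t)) ^ k) $ n"
proof -
  define D where "D = denom q t"
  define Dq where "Dq = D oo (fps_const q * fps_X)"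
  define H where "H = qexp q t"
  define Hq where "Hq = qexp q (t * q)"
  define F where "F = qexp q r * inverse D"
  define L where "L = (H - D) * inverse D"
  define Fq where "Fq = F oo (fps_const q * fps_X)"
  define Lq where "Lq = L oo (fps_const q * fps_X)"
  define u where "u = fps_X * inverse (1 - fps_X :: 'a fps)"
  define v where "v = fps_const t * (fps_X * inverse (1 - fps_const t * fps_X))"
  have D0: "D $ 0 = 1" by (simp add: D_def denom_nth_0 tq)
  have Dq0: "Dq $ 0 = 1" using D0 by (simp add: Dq_def)
  have D_inv: "D * inverse D = 1" using D0 by (intro inverse_mult_eq_1') simp
  have Dq_inv: "Dq * inverse Dq = 1" using Dq0 by (intro inverse_mult_eq_1') simp
  have X_inv: "(1 - fps_X) * inverse (1 - fps_X :: 'a fps) = 1"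
    by (intro inverse_mult_eq_1') simp
  have tX_inv: "(1 - fps_const t * fps_X) * inverse (1 - fps_const t * fps_X) = 1"
    by (intro inverse_mult_eq_1') simp
  have rX_inv: "(1 - fps_const r * fps_X) * inverse (1 - fps_const r * fps_X) = 1"
    by (intro inverse_mult_eq_1') simp
  have invD: "inverse D oo (fps_const q * fps_X) = inverse Dq"
    unfolding Dq_def using D0 by (intro fps_inverse_compose) auto
  have Fq: "Fq = (1 - fps_const r * fps_X) * qexp q r * inverse Dq"
    unfolding Fq_def F_def
    by (simp add: fps_compose_mult_distrib invD qexp_compose_linear qexp_dilate[OF nz])
  have Lq: "Lq = (Hq - Dq) * inverse Dq"
    unfolding Lq_def L_def
    by (simp add: fps_compose_mult_distrib fps_compose_sub_distrib invD H_def Hq_def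
        qexp_compose_linear Dq_def)
  have HqH: "Hq = (1 - fps_const t * fps_X) * H"
    unfolding H_def Hq_def by (rule qexp_dilate[OF nz])
  have dil: "(1 - fps_X) * D = Dq - fps_X * Hq"
    unfolding D_def Dq_def Hq_def by (rule denom_dilate[OF nz tq])

  have Lq1: "1 + Lq = Hq * inverse Dq"
    using Dq_inv by (simp add: Lq algebra_simps)
  have loop: "1 - u * Lq = D * inverse Dq"
  proof -
    have "(1 - fps_X) * (1 - u * Lq) = (1 - fps_X) - ((1 - fps_X) * inverse (1 - fps_X)) * fps_X * Lq"
      by (simp add: u_def algebra_simps)
    also have "\<dots> = 1 - fps_X * (1 + Lq)"
      unfolding X_inv by (simp add: algebra_simps)
    also have "\<dots> = Dq * inverse Dq - fps_X * Hq * inverse Dq"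
      unfolding Lq1 Dq_inv by (simp add: mult.assoc)
    also have "\<dots> = (1 - fps_X) * (D * inverse Dq)"
      using dil by (simp add: left_diff_distrib mult.assoc[symmetric])
    finally show ?thesis
      using X_inv by (metis mult_cancel_left mult_zero_left zero_neq_one)
  qed
  have inv_loop: "inverse (1 - u * Lq) = Dq * inverse D"
  proof -
    have "(1 - u * Lq) * (Dq * inverse D) = (Dq * inverse Dq) * (D * inverse D)"
      unfolding loop by (simp only: mult_ac)
    then have "(1 - u * Lq) * (Dq * inverse D) = 1" using D_inv Dq_inv by simp
    then show ?thesis
      using fps_inverse_unique by blast
  qed
  \<comment> \<open>\<open>h\<close> is the point at which summing the diagonal coefficients evaluates the polynomial.\<close>
  define h where "h = u * (1 + Lq) * inverse (1 - u * Lq)"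
  have h1: "(1 - fps_X) * (1 + h) = Dq * inverse D"
  proof -
    have "h = u * Hq * inverse D * (Dq * inverse Dq)"
      unfolding h_def inv_loop Lq1 by (simp only: mult_ac)
    then have "(1 - fps_X) * (1 + h) =
        (1 - fps_X) * (D * inverse D) + ((1 - fps_X) * inverse (1 - fps_X)) * fps_X * Hq * inverse D"
      unfolding Dq_inv D_inv by (simp add: u_def algebra_simps)
    also have "\<dots> = ((1 - fps_X) * D + fps_X * Hq) * inverse D"
      unfolding X_inv by (simp add: algebra_simps)
    finally show ?thesis unfolding dil by simp
  qed
  have Lh: "Lq * (1 + h) = (Hq - D) * inverse D"
  proof -
    have *: "Hq - Dq = (1 - fps_X) * (Hq - D)"
      using dil by (simp add: algebra_simps)
    have "Lq * (1 + h) = (Hq - D) * inverse Dq * ((1 - fps_X) * (1 + h))"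
      unfolding Lq * by (simp only: mult_ac)
    also have "\<dots> = (Hq - D) * inverse D * (Dq * inverse Dq)"
      unfolding h1 by (simp only: mult_ac)
    finally show ?thesis unfolding Dq_inv by simp
  qed
  have HqV: "Hq * (1 + v) = H"
  proof -
    have "Hq * (1 + v) = (1 - fps_const t * fps_X) * H
        + ((1 - fps_const t * fps_X) * inverse (1 - fps_const t * fps_X)) * fps_const t * fps_X * H"
      unfolding HqH v_def by (simp add: algebra_simps)
    then show ?thesis unfolding tX_inv by (simp add: algebra_simps)
  qed
  have step: "Lq + v * (1 + Lq) + (Lq + v * Lq) * h = L"
  proof -
    have "Lq + v * (1 + Lq) + (Lq + v * Lq) * h = Lq * (1 + h) + v * (1 + Lq * (1 + h))"
      by (simp add: algebra_simps)
    also have "1 + Lq * (1 + h) = Hq * inverse D"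
      unfolding Lh using D_inv by (simp add: algebra_simps)
    also have "Lq * (1 + h) + v * (Hq * inverse D) = (Hq * (1 + v) - D) * inverse D"
      unfolding Lh by (simp add: algebra_simps)
    finally show ?thesis unfolding HqV L_def .
  qed
  have series: "(F * L ^ k) $ n =
      (\<Sum>N\<le>n. q ^ N * block_kernel t r (n - N) k (\<lambda>j. (F * L ^ j) $ N))" for n k
  proof -
    have dilate: "(Fq * Lq ^ j) $ N = q ^ N * (F * L ^ j) $ N" for j N
    proof -
      have "Fq * Lq ^ j = (F * L ^ j) oo (fps_const q * fps_X)"
        by (simp add: Fq_def Lq_def fps_compose_mult_distrib fps_compose_power)
      then show ?thesis by (simp add: fps_compose_linear)
    qed
    have "(\<Sum>N\<le>n. q ^ N * block_kernel t r (n - N) k (\<lambda>j. (F * L ^ j) $ N)) =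
        (\<Sum>N\<le>n. block_kernel t r (n - N) k (\<lambda>j. (Fq * Lq ^ j) $ N))"
      unfolding dilate block_kernel_mult ..
    also have "\<dots> = (Fq * inverse (1 - fps_const r * fps_X) * L ^ k * inverse (1 - u * Lq)) $ n"
    proof -
      have "Lq $ 0 = 0" by (simp add: Lq Hq_def Dq0)
      from geometric_family_kernel[OF this, of t r n k Fq] show ?thesis
        unfolding u_def[symmetric] v_def[symmetric] h_def[symmetric] step .
    qed
    also have "Fq * inverse (1 - fps_const r * fps_X) * L ^ k * inverse (1 - u * Lq) =
        ((1 - fps_const r * fps_X) * inverse (1 - fps_const r * fps_X)) * (Dq * inverse Dq) * (F * L ^ k)"
      unfolding Fq inv_loop F_def by (simp only: mult_ac)
    also have "\<dots> = F * L ^ k"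
      unfolding rX_inv Dq_inv by simp
    finally show ?thesis ..
  qed
  have init: "(\<lambda>k. open_sum q t r 0 {0..<0 + k} / qpoch q 0) = (\<lambda>k. (F * L ^ k) $ 0)"
  proof
    fix k
    have "F $ 0 = 1" "L $ 0 = 0" by (simp_all add: F_def L_def H_def D0)
    then show "open_sum q t r 0 {0..<0 + k} / qpoch q 0 = (F * L ^ k) $ 0"
      by (simp add: open_sum_0 power_0_left)
  qed
  have q: "q ^ n \<noteq> 1" if "n > 0" for n
    using that nz[of n] by (cases n) (simp_all add: qpoch_Suc)
  have "(\<lambda>k. open_sum q t r n {n..<n + k} / qpoch q n) = (\<lambda>k. (F * L ^ k) $ n)"
    by (rule kernel_recurrence_unique[OF open_sum_recurrence[OF nz] series init q])
  then show ?thesis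
    unfolding F_def L_def H_def D_def by (rule fun_cong)
qed

section \<open>The generating function\<close>

lemma A_maj_exc_fix_eq_open_sum: "A_maj_exc_fix n q t r = open_sum q t r n {}"
  unfolding A_maj_exc_fix_def open_sum_def
proof (rule sum.reindex_bij_witness[of _
      "\<lambda>xs i. if i \<in> {1..n} then Suc (xs ! (i - 1)) else i"
      "\<lambda>s. map (\<lambda>i. s (Suc i) - 1) [0..<n]"], goal_cases)
  case (1 s)
  then have s: "s permutes {1..n}" by simp
  show ?case
  proof
    fix i
    show "(if i \<in> {1..n} then Suc (map (\<lambda>i. s (Suc i) - 1) [0..<n] ! (i - 1)) else i) = s i"
    proof (cases "i \<in> {1..n}")
      case True
      then have "s i \<in> {1..n}" by (simp only: permutes_in_image[OF s])
      then show ?thesis using True by auto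
    next
      case False
      then show ?thesis using permutes_not_in[OF s False] by auto
    qed
  qed
next
  case (2 s)
  then have s: "s permutes {1..n}" by simp
  have rng: "s (Suc i) \<in> {1..n}" if "i < n" for i
    using that by (subst permutes_in_image[OF s]) simp
  have "inj_on (\<lambda>i. s (Suc i) - 1) {0..<n}"
  proof (rule inj_onI)
    fix i j assume "i \<in> {0..<n}" "j \<in> {0..<n}" "s (Suc i) - 1 = s (Suc j) - 1"
    then have "s (Suc i) = s (Suc j)" using rng[of i] rng[of j] by auto
    then show "i = j" using permutes_inj[OF s] by (auto dest: injD)
  qed
  moreover have "s (Suc i) - Suc 0 < n" if "i < n" for i
    using rng[OF that] by auto
  ultimately show ?case
    by (auto simp: open_perms_def distinct_map)
next
  case (3 xs)
  then have "length xs = n" by (simp add: open_perms_def)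
  then show ?case by (intro nth_equalityI) auto
next
  case (4 xs)
  then have xs: "length xs = n" "distinct xs" "set xs \<subseteq> {..<n}" by (auto simp: open_perms_def)
  let ?s = "\<lambda>i. if i \<in> {1..n} then Suc (xs ! (i - 1)) else i"
  have inj: "inj_on ?s {1..n}"
  proof (rule inj_onI)
    fix i j assume ij: "i \<in> {1..n}" "j \<in> {1..n}" "?s i = ?s j"
    then have "xs ! (i - 1) = xs ! (j - 1)" by simp
    then have "i - 1 = j - 1" using ij xs by (subst (asm) nth_eq_iff_index_eq) auto
    then show "i = j" using ij by auto
  qed
  have "xs ! i < n" if "i < n" for i
    using subsetD[OF xs(3) nth_mem[of i xs]] that xs(1) by simp
  then have "?s ` {1..n} \<subseteq> {1..n}" by (auto simp: Suc_le_eq)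
  then have "?s ` {1..n} = {1..n}"
    using inj by (intro endo_inj_surj) auto
  then have "bij_betw ?s {1..n} {1..n}" using inj by (simp add: bij_betw_def)
  then have "?s permutes {1..n}" by (rule bij_imp_permutes) auto
  then show ?case by simp
next
  case (5 s)
  then have s: "s permutes {1..n}" by simp
  let ?xs = "map (\<lambda>i. s (Suc i) - 1) [0..<n]"
  have rng: "1 \<le> s (Suc i) \<and> s (Suc i) \<le> n" if "i < n" for i
    using permutes_in_image[OF s, of "Suc i"] that by simp
  have "DES n s = Suc ` {i. Suc i < length ?xs \<and> ?xs ! Suc i < ?xs ! i}"
  proof (intro equalityI subsetI)
    fix i assume i: "i \<in> DES n s"
    then obtain l where l: "i = Suc l" by (cases i) (auto simp: DES_def)
    then show "i \<in> Suc ` {i. Suc i < length ?xs \<and> ?xs ! Suc i < ?xs ! i}"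
      using i rng[of l] rng[of "Suc l"] by (auto simp: DES_def intro!: diff_less_mono)
  next
    fix i assume "i \<in> Suc ` {i. Suc i < length ?xs \<and> ?xs ! Suc i < ?xs ! i}"
    then show "i \<in> DES n s" by (auto simp: DES_def)
  qed
  then have maj: "list_maj ?xs = maj n s"
    by (simp add: maj_def list_maj_def sum.reindex)
  have "exc n s = card {i \<in> {..<n}. i < s (Suc i) - 1}"
  proof -
    have "{i \<in> {1..<n}. i < s i} = Suc ` {i \<in> {..<n}. i < s (Suc i) - 1}"
    proof (intro equalityI subsetI)
      fix i assume i: "i \<in> {i \<in> {1..<n}. i < s i}"
      then obtain l where l: "i = Suc l" by (cases i) auto
      then show "i \<in> Suc ` {i \<in> {..<n}. i < s (Suc i) - 1}" using i by auto
    next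
      fix i assume "i \<in> Suc ` {i \<in> {..<n}. i < s (Suc i) - 1}"
      then obtain l where "i = Suc l" "l < n" "l < s (Suc l) - 1" by auto
      then show "i \<in> {i \<in> {1..<n}. i < s i}" using rng[of l] by auto
    qed
    then show ?thesis by (simp add: exc_def card_image)
  qed
  moreover have "fixpts n s = card {i \<in> {..<n}. s (Suc i) - 1 = i}"
  proof -
    have "{i \<in> {1..n}. s i = i} = Suc ` {i \<in> {..<n}. s (Suc i) - 1 = i}"
    proof (intro equalityI subsetI)
      fix i assume i: "i \<in> {i \<in> {1..n}. s i = i}"
      then obtain l where l: "i = Suc l" by (cases i) auto
      then show "i \<in> Suc ` {i \<in> {..<n}. s (Suc i) - 1 = i}" using i by auto
    next
      fix i assume "i \<in> Suc ` {i \<in> {..<n}. s (Suc i) - 1 = i}"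
      then obtain l where "i = Suc l" "l < n" "s (Suc l) - 1 = l" by auto
      then show "i \<in> {i \<in> {1..n}. s i = i}" using rng[of l] by auto
    qed
    then show ?thesis by (simp add: fixpts_def card_image)
  qed
  moreover have "list_wt t r ?xs =
      (\<Prod>i<n. if i < s (Suc i) - 1 then t else 1) * (\<Prod>i<n. if s (Suc i) - 1 = i then r else 1)"
    unfolding list_wt_def arrow_wt_def prod.distrib[symmetric]
    by (intro prod.cong) auto
  moreover have "\<dots> = t ^ card {i \<in> {..<n}. i < s (Suc i) - 1} * r ^ card {i \<in> {..<n}. s (Suc i) - 1 = i}"
    by (simp only: prod.inter_filter[OF finite_lessThan, symmetric] prod_constant)
  ultimately have "list_wt t r ?xs = t ^ exc n s * r ^ fixpts n s" by simp
  then show ?case by (simp only: maj mult.assoc)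
qed

lemma qpoch_eq_qfact: "qpoch q n = (1 - q) ^ n * qfact q n"
proof (induction n)
  case (Suc n)
  have "qfact q (Suc n) = qfact q n * qint q (Suc n)" by (simp add: qfact_def)
  moreover have "1 - q ^ Suc n = (1 - q) * qint q (Suc n)"
    unfolding qint_def by (rule one_diff_power_eq)
  ultimately show ?case using Suc by (simp add: qpoch_Suc mult_ac)
qed (simp add: qfact_def)

lemma exp_q_scaled_eq_qexp:
  assumes "q \<noteq> 1"
  shows "exp_q_scaled q c = qexp q c oo (fps_const (1 - q) * fps_X)"
  using assms
  by (simp add: exp_q_scaled_def exp_q_def qexp_def fps_compose_linear fps_eq_iff qpoch_eq_qfact)

theorem maj_exc_fix_generating_function:
  fixes q t r :: "'a::field"
  assumes q: "q \<noteq> 1" and qf: "\<And>n. qfact q n \<noteq> 0" and tq: "t * q \<noteq> 1"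
  shows "Abs_fps (\<lambda>n. A_maj_exc_fix n q t r / qfact q n) =
    (fps_const (1 - t * q) * exp_q_scaled q r) /
    (exp_q_scaled q (t * q) - fps_const (t * q) * exp_q q)"
proof -
  let ?z = "fps_const (1 - q) * fps_X"
  let ?den = "exp_q_scaled q (t * q) - fps_const (t * q) * exp_q q"
  have nz: "qpoch q n \<noteq> 0" for n using q qf by (simp add: qpoch_eq_qfact)
  have exp_q: "exp_q q = exp_q_scaled q 1"
    by (simp add: exp_q_scaled_def)
  have D0: "denom q t $ 0 \<noteq> 0" using denom_nth_0[OF tq] by simp
  have den0: "?den $ 0 \<noteq> 0"
    using tq by (simp add: exp_q exp_q_scaled_eq_qexp[OF q])
  have "Abs_fps (\<lambda>n. A_maj_exc_fix n q t r / qfact q n) = (qexp q r * inverse (denom q t)) oo ?z"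
  proof (rule fps_ext)
    fix n
    have "A_maj_exc_fix n q t r / qpoch q n = (qexp q r * inverse (denom q t)) $ n"
      using open_sum_eq_series[OF nz tq, of r n 0] by (simp add: A_maj_exc_fix_eq_open_sum)
    then show "Abs_fps (\<lambda>n. A_maj_exc_fix n q t r / qfact q n) $ n =
        ((qexp q r * inverse (denom q t)) oo ?z) $ n"
      unfolding fps_compose_linear using q qf by (simp add: qpoch_eq_qfact field_simps)
  qed
  also have "\<dots> = exp_q_scaled q r * inverse (denom q t oo ?z)"
    using D0 by (simp add: fps_compose_mult_distrib fps_inverse_compose exp_q_scaled_eq_qexp[OF q])
  also have "denom q t oo ?z = fps_const (inverse (1 - t * q)) * ?den"
    by (simp add: denom_def exp_q exp_q_scaled_eq_qexp[OF q] fps_compose_mult_distrib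
        fps_compose_sub_distrib)
  also have "inverse \<dots> = fps_const (1 - t * q) * inverse ?den"
    by (simp add: fps_inverse_mult fps_const_inverse)
  finally show ?thesis
    using den0 by (simp add: fps_divide_unit mult_ac)
qed

theorem corollary1p3:
  shows "Abs_fps (\<lambda>n. A_maj_exc_fix n q_var t_var r_var / qfact q_var n) =
    (fps_const (1 - t_var * q_var) * exp_q_scaled q_var r_var) /
    (exp_q_scaled q_var (t_var * q_var) - fps_const (t_var * q_var) * exp_q q_var)"
proof (rule maj_exc_fix_generating_function)
  show "q_var \<noteq> 1"
    by (simp add: q_var_def one_pCons flip: to_fract_1)
  show "t_var * q_var \<noteq> 1"
    using one_minus_tq_nonzero by auto
qed (rule qfact_q_var_nonzero)

end
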